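(* For all integers $r\ge 2$ and $n\ge r+5$, the pure $r$-dimensional simplicial complex $K_{n,r}$ on $n$ vertices (defined in the context) satisfies \[ \sum_{i=1}^{5}\lambda_{r-1,i}(K_{n,r})>\sum_{j=1}^{5}\deg^\top_{0,j}(K_{n,r}). \] Consequently, the Duval–Reiner conjecture (that $\boldsymbol\lambda_{r-1}(L)\preccurlyeq\mathbf d_0^\top(L)$ for every $r$-dimensional simplicial complex $L$) fails for $K_{n,r}$; i.e. $\boldsymbol\lambda_{r-1}(K_{n,r})\preccurlyeq\mathbf d_0^\top(K_{n,r})$ is false.
   Context: A (finite abstract) simplicial complex $K$ on a finite vertex set $V$ is a collection of subsets of $V$ closed under inclusion. An element of cardinality $i+1$ is an $i$-face; the dimension of $K$ is the maximum dimension of its faces. $S_i(K)$ is the set of $i$-faces and $f_i(K)=|S_i(K)|$. A pure $d$-dimensional complex is one all of whose facets (maximal faces) are $d$-faces; it consists of all subsets of its facets, so it is determined by $S_d(K)$. Fix a linear order on $V$ and orient every face by the increasing order of its vertices. The boundary map is $\partial_i[v_0,\dots,v_i]=\sum_{j=0}^i(-1)^j[v_0,\dots,\widehat{v_j},\dots,v_i]$, with matrix $B_i(K)\in\mathbb R^{f_{i-1}(K)\times f_i(K)}$. The $i$-dimensional up-Laplacian is $L_i^{\mathrm{up}}(K)=B_{i+1}(K)B_{i+1}(K)^\top$, and $\boldsymbol\lambda_i(K)=(\lambda_{i,1}(K)\ge\lambda_{i,2}(K)\ge\cdots)$ is its spectrum (with multiplicity) in nonincreasing order. For an $r$-dimensional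 complex $K$ and a vertex $v$, $\deg_0(K;v)$ is the number of $r$-faces containing $v$, and $\mathbf d_0^\top(K)=(\deg_{0,1}^\top(K)\ge\deg_{0,2}^\top(K)\ge\cdots)$ with $\deg^\top_{0,j}(K)=|\{v\in S_0(K):\deg_0(K;v)\ge j\}|$ for $j\ge 1$. Sequences are padded with zeros, and $\mathbf x\preccurlyeq\mathbf y$ means $\sum_{i=1}^\ell x_i\le\sum_{i=1}^\ell y_i$ for all $\ell\ge1$ and $\sum_{i\ge1}x_i=\sum_{i\ge1}y_i$. Construction. Write $abc$ for $\{a,b,c\}$. Let $K$ be the pure two-dimensional complex on vertices $1,\dots,7$ with facets \[ \begin{aligned} S_2(K)=\{&124,126,127,134,135,136,137,145,146,147,\\&156,157,167,256,456,457,467,567\}. \end{aligned} \] For an integer $q\ge0$, let $v_1,\dots,v_q$ be new distinct vertices and let $K_q$ be the pure two-dimensional complex with $S_2(K_q)=S_2(K)\cup\{\{1,4,v_h\}:1\le h\le q\}$. For $r\ge2$ and $n\ge r+5$, put $q=n-r-5$, let $A$ be a set of $r-2$ new vertices disjoint from $V(K_q)$ ($A=\emptyset$ if $r=2$), and let $K_{n,r}$ be the pure $r$-dimensional complex with facets $S_r(K_{n,r})=\{A\cup F:F\in S_2(K_q)\}$. It has $n$ vertices. *)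

theory Defs
  imports "Jordan_Normal_Form.Char_Poly"
begin

section \<open>Simplicial complexes\<close>

definition simplicial_complex :: "'a set set \<Rightarrow> bool" where
  "simplicial_complex K \<longleftrightarrow> finite (\<Union>K) \<and> (\<forall>\<sigma>\<in>K. \<forall>\<tau>. \<tau> \<subseteq> \<sigma> \<longrightarrow> \<tau> \<in> K)"

definition faces :: "nat \<Rightarrow> 'a set set \<Rightarrow> 'a set set" where
  "faces i K = {\<sigma> \<in> K. card \<sigma> = i + 1}"

definition vertices :: "'a set set \<Rightarrow> 'a set" where
  "vertices K = {v. {v} \<in> K}"

text \<open>The subtraction truncates; the value is the dimension only if \<open>K\<close> is finite and has a
  nonempty face.\<close>
definition dimension :: "'a set set \<Rightarrow> nat" where
  "dimension K = Max (card ` K) - 1"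

definition facets :: "'a set set \<Rightarrow> 'a set set" where
  "facets K = {\<sigma> \<in> K. \<forall>\<tau>\<in>K. \<sigma> \<subseteq> \<tau> \<longrightarrow> \<tau> = \<sigma>}"

definition pure_complex :: "nat \<Rightarrow> 'a set set \<Rightarrow> bool" where
  "pure_complex d K \<longleftrightarrow> simplicial_complex K \<and> K \<noteq> {} \<and> (\<forall>\<sigma>\<in>facets K. card \<sigma> = d + 1)"

definition generated_complex :: "'a set set \<Rightarrow> 'a set set" where
  "generated_complex F = {\<tau>. \<exists>\<sigma>\<in>F. \<tau> \<subseteq> \<sigma>}"


section \<open>Boundary matrices, up-Laplacians and their spectra\<close>

text \<open>The linear order on the vertices is a relation \<open>ord\<close>, with \<open>(u, v) \<in> ord\<close> read as
  \<open>u \<le> v\<close>. The position of \<open>v\<close> in \<open>\<sigma> = [v\<^sub>0, \<dots>, v\<^sub>i]\<close> is its index, counted from 0.\<close>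
definition position :: "'a rel \<Rightarrow> 'a set \<Rightarrow> 'a \<Rightarrow> nat" where
  "position ord \<sigma> v = card {u \<in> \<sigma>. u \<noteq> v \<and> (u, v) \<in> ord}"

text \<open>The coefficient of \<open>\<tau>\<close> in the boundary of \<open>\<sigma>\<close>.\<close>
definition boundary_coeff :: "'a rel \<Rightarrow> 'a set \<Rightarrow> 'a set \<Rightarrow> real" where
  "boundary_coeff ord \<tau> \<sigma> = (\<Sum>v\<in>\<sigma>. if \<tau> = \<sigma> - {v} then (- 1) ^ position ord \<sigma> v else 0)"

text \<open>Matrices are indexed by numbers, so the faces are enumerated in some fixed way; another
  enumeration conjugates the up-Laplacian by a permutation matrix.\<close>
definition face_list :: "nat \<Rightarrow> 'a set set \<Rightarrow> 'a set list" where
  "face_list i K = (SOME xs. distinct xs \<and> set xs = faces i K)"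

text \<open>The matrix of \<open>\<partial>\<^sub>i\<close>, for \<open>i \<ge> 1\<close>.\<close>
definition boundary_matrix :: "'a rel \<Rightarrow> nat \<Rightarrow> 'a set set \<Rightarrow> real mat" where
  "boundary_matrix ord i K =
     mat (card (faces (i - 1) K)) (card (faces i K))
       (\<lambda>(a, b). boundary_coeff ord (face_list (i - 1) K ! a) (face_list i K ! b))"

definition up_laplacian :: "'a rel \<Rightarrow> nat \<Rightarrow> 'a set set \<Rightarrow> real mat" where
  "up_laplacian ord i K =
     boundary_matrix ord (i + 1) K * transpose_mat (boundary_matrix ord (i + 1) K)"

text \<open>Real roots of the characteristic polynomial, with multiplicity; for a symmetric matrix this
  is the whole spectrum.\<close>
definition spectrum_list :: "real mat \<Rightarrow> real list" where
  "spectrum_list M = rev (sorted_list_of_multiset (proots (char_poly M)))"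

text \<open>Sequences are indexed from 1 and padded with zeros.\<close>
definition up_eigenvalue :: "'a rel \<Rightarrow> nat \<Rightarrow> 'a set set \<Rightarrow> nat \<Rightarrow> real" where
  "up_eigenvalue ord i K j =
     (let xs = spectrum_list (up_laplacian ord i K)
      in if 1 \<le> j \<and> j \<le> length xs then xs ! (j - 1) else 0)"


section \<open>Degrees and majorization\<close>

definition deg0 :: "'a set set \<Rightarrow> 'a \<Rightarrow> nat" where
  "deg0 K v = card {\<sigma> \<in> faces (dimension K) K. v \<in> \<sigma>}"

definition deg0_conj :: "'a set set \<Rightarrow> nat \<Rightarrow> nat" where
  "deg0_conj K j = card {v \<in> vertices K. j \<le> deg0 K v}"

text \<open>For finitely supported sequences indexed from 1; the value at 0 is ignored.\<close>
definition majorized :: "(nat \<Rightarrow> real) \<Rightarrow> (nat \<Rightarrow> real) \<Rightarrow> bool" where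
  "majorized x y \<longleftrightarrow>
     (\<forall>l\<ge>1. (\<Sum>i=1..l. x i) \<le> (\<Sum>i=1..l. y i)) \<and> (\<Sum>i. x (Suc i)) = (\<Sum>i. y (Suc i))"


section \<open>The complexes\<close>

definition base_complex :: "nat set set" where
  "base_complex = generated_complex
     {{1,2,4}, {1,2,6}, {1,2,7}, {1,3,4}, {1,3,5}, {1,3,6}, {1,3,7}, {1,4,5}, {1,4,6}, {1,4,7},
      {1,5,6}, {1,5,7}, {1,6,7}, {2,5,6}, {4,5,6}, {4,5,7}, {4,6,7}, {5,6,7}}"

text \<open>The new vertices are \<open>v 1, \<dots>, v q\<close>.\<close>
definition Kq :: "nat \<Rightarrow> (nat \<Rightarrow> nat) \<Rightarrow> nat set set" where
  "Kq q v = generated_complex (faces 2 base_complex \<union> {{1, 4, v h} | h. 1 \<le> h \<and> h \<le> q})"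

definition Knr :: "nat \<Rightarrow> nat \<Rightarrow> (nat \<Rightarrow> nat) \<Rightarrow> nat set \<Rightarrow> nat set set" where
  "Knr n r v A = generated_complex {A \<union> F | F. F \<in> faces 2 (Kq (n - r - 5) v)}"

end

theory Submission
  imports Defs "Jordan_Normal_Form.Spectral_Radius" "HOL-Combinatorics.Permutations"
begin

text \<open>By Ky Fan's principle the five largest eigenvalues of \<open>B B\<^sup>T\<close> dominate the sum of the
  quotients \<open>|B w|\<^sup>2 / |w|\<^sup>2\<close> over any five pairwise orthogonal vectors \<open>w\<close> indexed by the
  facets. Every apex in \<open>A\<close> adds 1 to each quotient, so it is enough to find test vectors on the
  triangles of \<open>K\<^sub>q\<close>. The star of the edge 14 has quotient \<open>7 + q\<close>. The other four
  vectors are orthogonal to it and vanish on the new triangles, so they are independent of \<open>q\<close>: two come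
  from the stars of the edges 16 and 17 (quotient 7 each), and two are integer approximations of the
  eigenvectors of \<open>K\<close> for the eigenvalues \<open>6.1638\<dots>\<close> and \<open>5.8363\<dots>\<close>, with quotients that add up to
  \<open>12.0001\<dots>\<close>. The total exceeds \<open>33 + q + 5|A|\<close>. On the other side, the first five conjugate degrees
  add up to the sum of \<open>min(5, deg u)\<close> over all vertices \<open>u\<close>, which is at most that number.\<close>

section \<open>Diagonalization of real symmetric matrices\<close>

text \<open>Over the complex numbers the spectrum is nonempty. For an eigenvector \<open>z\<close>
  with eigenvalue \<open>c\<close>, the Hermitian form of \<open>A\<close> at \<open>z\<close>
  equals \<open>c\<close> times the squared norm and, by symmetry, its own conjugate. So
  \<open>c\<close> is real and a root of the real characteristic polynomial.\<close>

lemma real_symmetric_eigenvalue: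
  fixes A :: "real mat"
  assumes A: "A \<in> carrier_mat n n" and sym: "transpose_mat A = A" and n: "n \<noteq> 0"
  shows "\<exists>e. eigenvalue A e"
proof -
  define C where "C = map_mat complex_of_real A"
  have C: "C \<in> carrier_mat n n"
    using A by (simp add: C_def)
  obtain c where "c \<in> spectrum C"
    using spectrum_non_empty[OF C] n by auto
  then obtain z where "eigenvector C z c"
    by (auto simp: spectrum_def eigenvalue_def)
  then have z: "z \<in> carrier_vec n" "z \<noteq> 0\<^sub>v n" and ev: "C *\<^sub>v z = c \<cdot>\<^sub>v z"
    using C by (auto simp: eigenvector_def)
  have symA: "A $$ (i, j) = A $$ (j, i)" if "i < n" "j < n" for i j
    using that A arg_cong[OF sym, of "\<lambda>M. M $$ (i, j)"] by simp
  have row: "(\<Sum>j<n. of_real (A $$ (i, j)) * z $ j) = c * z $ i" if "i < n" for i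
  proof -
    have "(C *\<^sub>v z) $ i = c * z $ i"
      using that z by (simp add: ev)
    then show ?thesis
      using that A z by (simp add: C_def scalar_prod_def atLeast0LessThan)
  qed
  define S where "S = (\<Sum>i<n. \<Sum>j<n. of_real (A $$ (i, j)) * z $ j * cnj (z $ i))"
  define N where "N = (\<Sum>i<n. (cmod (z $ i))\<^sup>2)"
  have "S = (\<Sum>i<n. c * z $ i * cnj (z $ i))"
    unfolding S_def by (intro sum.cong refl) (simp add: row flip: sum_distrib_right)
  also have "\<dots> = c * of_real N"
    unfolding N_def of_real_sum sum_distrib_left
    by (intro sum.cong refl) (simp add: mult.assoc flip: complex_norm_square)
  finally have S: "S = c * of_real N" .
  have "cnj S = (\<Sum>i<n. \<Sum>j<n. of_real (A $$ (i, j)) * cnj (z $ j) * z $ i)"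
    by (simp add: S_def)
  also have "\<dots> = (\<Sum>j<n. \<Sum>i<n. of_real (A $$ (i, j)) * cnj (z $ j) * z $ i)"
    by (rule sum.swap)
  also have "\<dots> = S"
    unfolding S_def by (intro sum.cong refl) (simp add: symA)
  finally have "cnj S = S" .
  moreover have "N \<noteq> 0"
  proof
    assume "N = 0"
    then have "\<forall>i<n. z $ i = 0"
      by (auto simp: N_def sum_nonneg_eq_0_iff)
    then show False
      using z by (metis carrier_vecD eq_vecI index_zero_vec)
  qed
  ultimately have "cnj c = c"
    by (simp add: S)
  then obtain e where e: "c = of_real e"
    by (metis Reals_cases Reals_cnj_iff)
  have "poly (char_poly C) c = 0"
    using \<open>c \<in> spectrum C\<close> eigenvalue_root_char_poly[OF C] by (simp add: spectrum_def)
  then have "poly (char_poly A) e = 0"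
    by (simp add: C_def e of_real_hom.char_poly_hom[OF A])
  then show ?thesis
    using eigenvalue_root_char_poly[OF A] by blast
qed

text \<open>Gram-Schmidt applied to a basis that starts with \<open>v\<close> leaves
  \<open>v\<close> in first place, and rescaling the columns to unit length makes the matrix
  orthogonal. Only the direction of the first column matters later, so \<open>c\<close> stays
  unspecified.\<close>

lemma orthonormal_completion:
  fixes v :: "real vec"
  assumes v: "v \<in> carrier_vec n" "v \<noteq> 0\<^sub>v n"
  shows "\<exists>W c. W \<in> carrier_mat n n \<and> transpose_mat W * W = 1\<^sub>m n \<and> col W 0 = c \<cdot>\<^sub>v v"
proof -
  interpret cof_vec_space n "TYPE(real)" .
  define ws where "ws = gram_schmidt n (basis_completion v)"
  note b = basis_completion[OF v]
  note gs = gram_schmidt_result[OF b(2,4,5) refl, folded ws_def]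
  have n: "n \<noteq> 0"
    using v by auto
  have len: "length ws = n"
    using gs(4) b(6) by simp
  have ws: "ws ! i \<in> carrier_vec n" if "i < n" for i
    using that gs(3) len by (metis nth_mem subsetD)
  have hd: "ws ! 0 = v"
    using gram_schmidt_hd[OF v(1), of "tl (basis_completion v)"] b(7) b(6) n len
    by (metis gs(4) hd_conv_nth length_0_conv list.collapse ws_def)
  have orth: "ws ! i \<bullet> ws ! j = 0 \<longleftrightarrow> i \<noteq> j" if "i < n" "j < n" for i j
    using corthogonalD[OF gs(2), of i j] that len by simp
  define k where "k i = 1 / sqrt (ws ! i \<bullet> ws ! i)" for i
  define W where "W = mat n n (\<lambda>(i, j). k j * (ws ! j) $ i)"
  have col: "col W j = k j \<cdot>\<^sub>v (ws ! j)" if "j < n" for j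
    using that ws[OF that] by (auto simp: W_def)
  have "transpose_mat W * W = 1\<^sub>m n"
  proof (rule eq_matI)
    fix i j assume ij: "i < dim_row (1\<^sub>m n :: real mat)" "j < dim_col (1\<^sub>m n :: real mat)"
    then have ij: "i < n" "j < n"
      by auto
    have "(transpose_mat W * W) $$ (i, j) = col W i \<bullet> col W j"
      using ij by (simp add: W_def)
    also have "\<dots> = k i * k j * (ws ! i \<bullet> ws ! j)"
      using ij ws
      by (simp add: col smult_scalar_prod_distrib[of _ n] scalar_prod_smult_distrib[of _ n])
    also have "\<dots> = (if i = j then 1 else 0)"
    proof (cases "i = j")
      case True
      have "ws ! i \<bullet> ws ! i \<ge> 0"
        by (simp add: scalar_prod_def sum_nonneg)
      then show ?thesis
        using True orth[OF ij] by (simp add: k_def)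
    qed (use orth[OF ij] in simp)
    finally show "(transpose_mat W * W) $$ (i, j) = 1\<^sub>m n $$ (i, j)"
      using ij by simp
  qed (simp_all add: W_def)
  moreover have "col W 0 = k 0 \<cdot>\<^sub>v v"
    using col[of 0] n hd by simp
  ultimately show ?thesis
    by (metis W_def mat_carrier)
qed

text \<open>Deflation: in an orthonormal basis whose first vector is an eigenvector, symmetry makes
  the matrix block diagonal with a 1 by 1 corner, and the induction hypothesis diagonalizes the
  other block.\<close>

theorem real_symmetric_diagonalization:
  fixes A :: "real mat"
  assumes "A \<in> carrier_mat n n" and "transpose_mat A = A"
  shows "\<exists>P d. P \<in> carrier_mat n n \<and> transpose_mat P * P = 1\<^sub>m n
           \<and> transpose_mat P * A * P = mat_diag n d"
  using assms
proof (induction n arbitrary: A)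
  case 0
  then show ?case
    by (intro exI[of _ "1\<^sub>m 0"] exI[of _ "\<lambda>_. 0"]) (auto simp: mat_diag_def)
next
  case (Suc n A)
  note A = Suc.prems(1)
  obtain e v where v: "v \<in> carrier_vec (Suc n)" "v \<noteq> 0\<^sub>v (Suc n)" "A *\<^sub>v v = e \<cdot>\<^sub>v v"
    using real_symmetric_eigenvalue[OF Suc.prems] A by (auto simp: eigenvalue_def eigenvector_def)
  obtain W c where W: "W \<in> carrier_mat (Suc n) (Suc n)" "transpose_mat W * W = 1\<^sub>m (Suc n)"
    and col0: "col W 0 = c \<cdot>\<^sub>v v"
    using orthonormal_completion[OF v(1,2)] by blast
  have Wt: "transpose_mat W \<in> carrier_mat (Suc n) (Suc n)"
    using W by simp
  define M where "M = transpose_mat W * A * W"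
  have M: "M \<in> carrier_mat (Suc n) (Suc n)"
    using A W by (simp add: M_def)
  have symM: "transpose_mat M = M"
  proof -
    have "transpose_mat M = transpose_mat W * transpose_mat (transpose_mat W * A)"
      unfolding M_def by (rule transpose_mult[of _ "Suc n" "Suc n"]) (use A W in auto)
    also have "transpose_mat (transpose_mat W * A) = A * W"
      by (subst transpose_mult[of _ "Suc n" "Suc n"]) (use A W Suc.prems(2) in auto)
    finally show ?thesis
      unfolding M_def using A W Wt by simp
  qed
  \<comment> \<open>\<open>M\<close> is \<open>A\<close> in the basis of the columns of
    \<open>W\<close>, and \<open>col W 0\<close> is a multiple of the eigenvector \<open>v\<close>,
    so the first column of \<open>M\<close> is \<open>e\<close> times the first unit vector.\<close>
  have M0: "M $$ (i, 0) = (if i = 0 then e else 0)" if i: "i < Suc n" for i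
  proof -
    have cW: "col W 0 \<in> carrier_vec (Suc n)"
      using W by (metis carrier_matD(1) col_dim)
    have WtA: "transpose_mat W * A \<in> carrier_mat (Suc n) (Suc n)"
      using A Wt by simp
    have "col M 0 = transpose_mat W *\<^sub>v (A *\<^sub>v col W 0)"
      unfolding M_def col_mult2[OF WtA W(1) zero_less_Suc]
      by (rule assoc_mult_mat_vec[OF Wt A cW])
    also have "A *\<^sub>v col W 0 = e \<cdot>\<^sub>v col W 0"
      unfolding col0 using A v by (simp add: mult_mat_vec smult_smult_assoc mult.commute)
    also have "transpose_mat W *\<^sub>v (e \<cdot>\<^sub>v col W 0) = e \<cdot>\<^sub>v col (transpose_mat W * W) 0"
      unfolding col_mult2[OF Wt W(1) zero_less_Suc] by (rule mult_mat_vec[OF Wt]) (rule cW)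
    finally have "col M 0 $ i = (e \<cdot>\<^sub>v col (1\<^sub>m (Suc n)) 0) $ i"
      by (simp add: W)
    then show ?thesis
      using M i by simp
  qed
  define A3 where "A3 = mat n n (\<lambda>(i, j). M $$ (Suc i, Suc j))"
  have A3: "A3 \<in> carrier_mat n n"
    by (simp add: A3_def)
  have symM': "M $$ (i, j) = M $$ (j, i)" if "i < Suc n" "j < Suc n" for i j
    using that M arg_cong[OF symM, of "\<lambda>M. M $$ (i, j)"] by simp
  have "transpose_mat A3 = A3"
    by (rule eq_matI) (auto simp: A3_def intro: symM')
  from Suc.IH[OF A3 this] obtain P' d where
    P': "P' \<in> carrier_mat n n" "transpose_mat P' * P' = 1\<^sub>m n"
    and d: "transpose_mat P' * A3 * P' = mat_diag n d"
    by blast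
  \<comment> \<open>\<open>Q\<close> fixes the first basis vector and acts as \<open>P'\<close> on
    the rest; \<open>W * Q\<close> is the matrix sought for \<open>A\<close>.\<close>
  define Q where "Q = four_block_mat (1\<^sub>m 1) (0\<^sub>m 1 n) (0\<^sub>m n 1) P'"
  have Q: "Q \<in> carrier_mat (Suc n) (Suc n)"
    using P' by (auto simp: Q_def)
  have Qt: "transpose_mat Q = four_block_mat (1\<^sub>m 1) (0\<^sub>m 1 n) (0\<^sub>m n 1) (transpose_mat P')"
    unfolding Q_def by (subst transpose_four_block_mat[of _ 1 1 _ n _ n]) (use P' in auto)
  have M0': "M $$ (0, j) = (if j = 0 then e else 0)" if "j < Suc n" for j
    using that symM'[of 0 j] M0 by simp
  have Mblock: "M = four_block_mat (mat 1 1 (\<lambda>_. e)) (0\<^sub>m 1 n) (0\<^sub>m n 1) A3"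
    by (rule eq_matI) (use M M0 M0' in \<open>auto simp: A3_def less_Suc_eq_0_disj\<close>)
  have QQ: "transpose_mat Q * Q = 1\<^sub>m (Suc n)"
    unfolding Qt unfolding Q_def
    by (subst mult_four_block_mat[of _ 1 1 _ n _ n _ _ 1 _ n])
       (use P' in \<open>auto intro!: eq_matI\<close>)
  have QMQ: "transpose_mat Q * M * Q = mat_diag (Suc n) (case_nat e d)"
  proof -
    have "transpose_mat Q * M = four_block_mat (mat 1 1 (\<lambda>_. e)) (0\<^sub>m 1 n) (0\<^sub>m n 1) (transpose_mat P' * A3)"
      unfolding Qt Mblock
      by (subst mult_four_block_mat[of _ 1 1 _ n _ n _ _ 1 _ n]) (use P' A3 in auto)
    then have "transpose_mat Q * M * Q
        = four_block_mat (mat 1 1 (\<lambda>_. e)) (0\<^sub>m 1 n) (0\<^sub>m n 1) (transpose_mat P' * A3 * P')"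
      unfolding Q_def
      by (simp only:, subst mult_four_block_mat[of _ 1 1 _ n _ n _ _ 1 _ n]) (use P' A3 in auto)
    also have "\<dots> = mat_diag (Suc n) (case_nat e d)"
      unfolding d by (rule eq_matI) (auto simp: mat_diag_def split: nat.split)
    finally show ?thesis .
  qed
  have tWQ: "transpose_mat (W * Q) = transpose_mat Q * transpose_mat W"
    by (rule transpose_mult[OF W(1) Q])
  have Qt': "transpose_mat Q \<in> carrier_mat (Suc n) (Suc n)"
    using Q by simp
  have "transpose_mat (W * Q) * (W * Q) = transpose_mat Q * (transpose_mat W * W) * Q"
    unfolding tWQ using W(1) Q Wt Qt' by (simp add: assoc_mult_mat[of _ "Suc n" "Suc n" _ "Suc n" _ "Suc n"])
  also have "\<dots> = 1\<^sub>m (Suc n)"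
    using QQ Qt' by (simp add: W(2))
  finally have 1: "transpose_mat (W * Q) * (W * Q) = 1\<^sub>m (Suc n)" .
  have "transpose_mat (W * Q) * A * (W * Q) = transpose_mat Q * M * Q"
    unfolding tWQ M_def using A W(1) Q Wt Qt'
    by (simp add: assoc_mult_mat[of _ "Suc n" "Suc n" _ "Suc n" _ "Suc n"])
  then have "transpose_mat (W * Q) * A * (W * Q) = mat_diag (Suc n) (case_nat e d)"
    using QMQ by simp
  with 1 W(1) Q show ?case
    by (metis mult_carrier_mat)
qed

text \<open>An orthogonal change of basis is a similarity, so \<open>A\<close> has the
  characteristic polynomial of the diagonal matrix. This identifies the entries of \<open>d\<close>,
  with multiplicity, as the numbers that \<open>spectrum_list\<close> sorts.\<close>

lemma proots_char_poly_diagonalizable: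
  fixes A :: "real mat"
  assumes A: "A \<in> carrier_mat n n" and P: "P \<in> carrier_mat n n" "transpose_mat P * P = 1\<^sub>m n"
    and d: "transpose_mat P * A * P = mat_diag n d"
  shows "proots (char_poly A) = mset (map d [0..<n])"
proof -
  have Pt: "transpose_mat P \<in> carrier_mat n n"
    using P by simp
  have PPt: "P * transpose_mat P = 1\<^sub>m n"
    using mat_mult_left_right_inverse[OF Pt P(1) P(2)] .
  have "similar_mat_wit (mat_diag n d) A (transpose_mat P) P"
    by (rule similar_mat_witI[of _ _ n]) (use A P Pt PPt d in auto)
  then have "char_poly A = char_poly (mat_diag n d)"
    using char_poly_similar by (metis similar_mat_def)
  also have "\<dots> = (\<Prod>a \<leftarrow> diag_mat (mat_diag n d). [:- a, 1:])"
    by (rule char_poly_upper_triangular[of _ n]) (auto simp: mat_diag_def)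
  also have "diag_mat (mat_diag n d) = map d [0..<n]"
    by (auto simp: diag_mat_def mat_diag_def)
  finally have "char_poly A = (\<Prod>a \<leftarrow> map d [0..<n]. [:- a, 1:])" .
  moreover have "proots (\<Prod>a\<leftarrow>xs. [:- a, 1:]) = mset xs" for xs :: "real list"
  proof (induction xs)
    case (Cons a xs)
    have "(\<Prod>a\<leftarrow>xs. [:- a, 1:]) \<noteq> 0"
      by (auto simp: prod_list_zero_iff)
    then show ?case
      using Cons by (simp add: proots_mult del: mult_pCons_left)
  qed simp
  ultimately show ?thesis
    by metis
qed


section \<open>Ky Fan's principle\<close>

text \<open>A vector \<open>u i\<close> that vanishes on \<open>X\<close> contributes \<open>0 / 0 = 0\<close>.\<close>
lemma bessel_inequality:
  fixes u :: "'i \<Rightarrow> 'x \<Rightarrow> real" and f :: "'x \<Rightarrow> real"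
  assumes fin: "finite I" "finite X"
    and orth: "\<And>i j. i \<in> I \<Longrightarrow> j \<in> I \<Longrightarrow> i \<noteq> j \<Longrightarrow> (\<Sum>x\<in>X. u i x * u j x) = 0"
  shows "(\<Sum>i\<in>I. (\<Sum>x\<in>X. u i x * f x)\<^sup>2 / (\<Sum>x\<in>X. (u i x)\<^sup>2)) \<le> (\<Sum>x\<in>X. (f x)\<^sup>2)"
proof -
  define s where "s i = (\<Sum>x\<in>X. u i x * f x)" for i
  define N where "N i = (\<Sum>x\<in>X. (u i x)\<^sup>2)" for i
  define a where "a i = s i / N i" for i
  \<comment> \<open>The residual of \<open>f\<close> after subtracting its projections onto the
    \<open>u i\<close> has a nonnegative squared norm; in the expansion the mixed terms vanish by
    orthogonality.\<close>
  have "0 \<le> (\<Sum>x\<in>X. (f x - (\<Sum>i\<in>I. a i * u i x))\<^sup>2)"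
    by (simp add: sum_nonneg)
  also have "\<dots> = (\<Sum>x\<in>X. (f x)\<^sup>2) - 2 * (\<Sum>x\<in>X. \<Sum>i\<in>I. a i * (u i x * f x))
      + (\<Sum>x\<in>X. \<Sum>i\<in>I. \<Sum>j\<in>I. a i * a j * (u i x * u j x))"
    by (simp add: power2_diff sum.distrib sum_subtractf sum_distrib_left sum_distrib_right
        power2_eq_square[of "sum _ _"] algebra_simps)
  also have "(\<Sum>x\<in>X. \<Sum>i\<in>I. a i * (u i x * f x)) = (\<Sum>i\<in>I. a i * s i)"
    by (subst sum.swap) (simp add: s_def sum_distrib_left)
  also have "(\<Sum>x\<in>X. \<Sum>i\<in>I. \<Sum>j\<in>I. a i * a j * (u i x * u j x))
      = (\<Sum>i\<in>I. \<Sum>j\<in>I. a i * a j * (\<Sum>x\<in>X. u i x * u j x))"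
    by (subst sum.swap, rule sum.cong[OF refl], subst sum.swap) (simp add: sum_distrib_left)
  also have "\<dots> = (\<Sum>i\<in>I. (a i)\<^sup>2 * N i)"
  proof (rule sum.cong[OF refl])
    fix i assume i: "i \<in> I"
    have "(\<Sum>j\<in>I. a i * a j * (\<Sum>x\<in>X. u i x * u j x)) = (\<Sum>j\<in>I. if j = i then (a i)\<^sup>2 * N i else 0)"
      by (rule sum.cong) (auto simp: orth[OF i] N_def power2_eq_square)
    then show "(\<Sum>j\<in>I. a i * a j * (\<Sum>x\<in>X. u i x * u j x)) = (a i)\<^sup>2 * N i"
      using i fin by simp
  qed
  also have "(\<Sum>i\<in>I. (a i)\<^sup>2 * N i) = (\<Sum>i\<in>I. (s i)\<^sup>2 / N i)"
    by (rule sum.cong) (auto simp: a_def power2_eq_square)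
  also have "(\<Sum>i\<in>I. a i * s i) = (\<Sum>i\<in>I. (s i)\<^sup>2 / N i)"
    by (rule sum.cong) (auto simp: a_def power2_eq_square)
  finally show ?thesis
    by (simp add: s_def N_def)
qed

text \<open>The best use of a total weight of at most \<open>k\<close> is weight 1 on the
  \<open>k\<close> largest values. The deviation \<open>c'\<close> from that choice is nonpositive
  before \<open>k\<close> and nonnegative from \<open>k\<close> on, so replacing \<open>L i\<close>
  by \<open>L k\<close> can only increase the sum.\<close>

lemma weighted_sum_le_sum_largest:
  fixes L c :: "nat \<Rightarrow> real"
  assumes "antimono L" and L0: "\<And>i. 0 \<le> L i"
    and c: "\<And>i. i < m \<Longrightarrow> 0 \<le> c i" "\<And>i. i < m \<Longrightarrow> c i \<le> 1" and ck: "(\<Sum>i<m. c i) \<le> real k"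
  shows "(\<Sum>i<m. L i * c i) \<le> (\<Sum>i<k. L i)"
proof (cases "m \<le> k")
  case True
  have "(\<Sum>i<m. L i * c i) \<le> (\<Sum>i<m. L i)"
    by (rule sum_mono) (use c L0 in \<open>simp add: mult_left_le\<close>)
  also have "\<dots> \<le> (\<Sum>i<k. L i)"
    by (rule sum_mono2) (use True L0 in auto)
  finally show ?thesis .
next
  case False
  define c' where "c' i = c i - (if i < k then 1 else 0)" for i
  have split: "(\<Sum>i<m. g i * (if i < k then 1 else 0)) = (\<Sum>i<k. g i)" for g :: "nat \<Rightarrow> real"
  proof -
    have "(\<Sum>i<m. g i * (if i < k then 1 else 0)) = (\<Sum>i<m. if i \<in> {..<k} then g i else 0)"
      by (rule sum.cong) auto
    also have "\<dots> = (\<Sum>i\<in>{..<m} \<inter> {..<k}. g i)"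
      by (simp add: sum.inter_restrict)
    also have "{..<m} \<inter> {..<k} = {..<k}"
      using False by auto
    finally show ?thesis .
  qed
  have "(\<Sum>i<m. L i * c' i) \<le> (\<Sum>i<m. L k * c' i)"
  proof (rule sum_mono)
    fix i assume "i \<in> {..<m}"
    then show "L i * c' i \<le> L k * c' i"
      using c[of i] antimonoD[OF \<open>antimono L\<close>, of i k] antimonoD[OF \<open>antimono L\<close>, of k i]
      by (cases "i < k") (auto simp: c'_def intro: mult_right_mono mult_right_mono_neg)
  qed
  also have "\<dots> = L k * ((\<Sum>i<m. c i) - real k)"
    using split[of "\<lambda>_. 1"]
    by (simp add: c'_def sum_subtractf flip: sum_distrib_left)
  also have "\<dots> \<le> 0"
    using ck L0[of k] by (simp add: mult_nonneg_nonpos)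
  finally show ?thesis
    using split[of L] by (simp add: c'_def right_diff_distrib sum_subtractf)
qed

text \<open>Using test vectors in the domain of \<open>B\<close> avoids having to compare the spectra of
  \<open>B B\<^sup>T\<close> and \<open>B\<^sup>T B\<close>.\<close>
theorem ky_fan_gram:
  fixes B :: "real mat" and w :: "nat \<Rightarrow> nat \<Rightarrow> real"
  assumes B: "B \<in> carrier_mat m n"
    and orth: "\<And>i j. i < k \<Longrightarrow> j < k \<Longrightarrow> i \<noteq> j \<Longrightarrow> (\<Sum>b<n. w i b * w j b) = 0"
  defines "xs \<equiv> spectrum_list (B * transpose_mat B)"
  shows "(\<Sum>j<k. (\<Sum>a<m. (\<Sum>b<n. B $$ (a, b) * w j b)\<^sup>2) / (\<Sum>b<n. (w j b)\<^sup>2))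
           \<le> (\<Sum>i<k. if i < length xs then xs ! i else 0)"
proof -
  define A where "A = B * transpose_mat B"
  have Bt: "transpose_mat B \<in> carrier_mat n m"
    using B by simp
  have A: "A \<in> carrier_mat m m"
    using B by (simp add: A_def)
  have "transpose_mat A = A"
    unfolding A_def using B by (simp add: transpose_mult[OF B Bt])
  from real_symmetric_diagonalization[OF A this] obtain P d where
    P: "P \<in> carrier_mat m m" "transpose_mat P * P = 1\<^sub>m m"
    and PAP: "transpose_mat P * A * P = mat_diag m d"
    by blast
  have Pt: "transpose_mat P \<in> carrier_mat m m"
    using P by simp
  have PPt: "P * transpose_mat P = 1\<^sub>m m"
    using mat_mult_left_right_inverse[OF Pt P(1) P(2)] .
  \<comment> \<open>\<open>Y\<close> is \<open>B\<close> seen in the eigenbasis: its rows are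
    pairwise orthogonal with squared norms \<open>d i\<close>.\<close>
  define Y where "Y = transpose_mat P * B"
  have Y: "Y \<in> carrier_mat m n"
    using Pt B by (simp add: Y_def)
  have BPY: "B = P * Y"
    unfolding Y_def using B P(1) Pt PPt by (simp flip: assoc_mult_mat)
  have YY: "Y * transpose_mat Y = mat_diag m d"
  proof -
    have "transpose_mat Y = transpose_mat B * P"
      unfolding Y_def using P by (simp add: transpose_mult[OF Pt B])
    then have "Y * transpose_mat Y = transpose_mat P * (B * (transpose_mat B * P))"
      unfolding Y_def using Pt B Bt P(1)
      by (simp add: assoc_mult_mat[OF Pt B, of "transpose_mat B * P" m])
    also have "\<dots> = transpose_mat P * (A * P)"
      unfolding A_def using assoc_mult_mat[OF B Bt P(1)] by simp
    also have "\<dots> = transpose_mat P * A * P"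
      using assoc_mult_mat[OF Pt A P(1)] by simp
    finally show ?thesis
      by (simp add: PAP)
  qed
  have Yrow: "(\<Sum>b<n. Y $$ (i, b) * Y $$ (j, b)) = (if i = j then d i else 0)"
    if "i < m" "j < m" for i j
  proof -
    have "(\<Sum>b<n. Y $$ (i, b) * Y $$ (j, b)) = (Y * transpose_mat Y) $$ (i, j)"
      using that Y by (simp add: scalar_prod_def atLeast0LessThan)
    then show ?thesis
      using that by (simp add: YY mat_diag_def)
  qed
  have Prow: "(\<Sum>i<m. P $$ (a, i) * P $$ (b, i)) = (if a = b then 1 else 0)"
    if "a < m" "b < m" for a b
  proof -
    have "(P * transpose_mat P) $$ (a, b) = (\<Sum>i<m. P $$ (a, i) * P $$ (b, i))"
      using that P by (simp add: scalar_prod_def atLeast0LessThan)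
    then show ?thesis
      using that by (simp add: PPt)
  qed
  define z where "z i j = (\<Sum>b<n. Y $$ (i, b) * w j b)" for i j
  define N where "N j = (\<Sum>b<n. (w j b)\<^sup>2)" for j
  \<comment> \<open>The weight of the eigenvalue \<open>d i\<close>: the sum of the squared cosines
    of the angles between row \<open>i\<close> of \<open>Y\<close> and the vectors
    \<open>w j\<close>. For \<open>d i = 0\<close>, division by zero makes it 0.\<close>
  define c where "c i = (\<Sum>j<k. (z i j)\<^sup>2 / N j) / d i" for i
  have dsq: "d i = (\<Sum>b<n. (Y $$ (i, b))\<^sup>2)" if "i < m" for i
    using Yrow[OF that that] by (simp add: power2_eq_square)
  have d0: "0 \<le> d i" if "i < m" for i
    by (simp add: dsq[OF that] sum_nonneg)
  have N0: "0 \<le> N j" for j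
    by (simp add: N_def sum_nonneg)
  \<comment> \<open>The rows of \<open>P\<close> are orthonormal, so Bessel's inequality for them
    says that \<open>P\<close> does not increase norms, which is the direction needed.\<close>
  have le: "(\<Sum>a<m. (\<Sum>b<n. B $$ (a, b) * w j b)\<^sup>2) \<le> (\<Sum>i<m. (z i j)\<^sup>2)" for j
  proof -
    have "(\<Sum>b<n. B $$ (a, b) * w j b) = (\<Sum>i<m. P $$ (a, i) * z i j)" if "a < m" for a
    proof -
      have "(\<Sum>b<n. B $$ (a, b) * w j b) = (\<Sum>b<n. \<Sum>i<m. P $$ (a, i) * Y $$ (i, b) * w j b)"
        using that P Y unfolding BPY
        by (intro sum.cong refl) (simp add: scalar_prod_def atLeast0LessThan sum_distrib_right)
      also have "\<dots> = (\<Sum>i<m. P $$ (a, i) * z i j)"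
        by (subst sum.swap) (simp add: z_def sum_distrib_left mult.assoc)
      finally show ?thesis .
    qed
    then have "(\<Sum>a<m. (\<Sum>b<n. B $$ (a, b) * w j b)\<^sup>2)
        = (\<Sum>a<m. (\<Sum>i<m. P $$ (a, i) * z i j)\<^sup>2 / (\<Sum>i<m. (P $$ (a, i))\<^sup>2))"
      using Prow by (intro sum.cong) (auto simp: power2_eq_square)
    also have "\<dots> \<le> (\<Sum>i<m. (z i j)\<^sup>2)"
      by (rule bessel_inequality) (use Prow in auto)
    finally show ?thesis .
  qed
  \<comment> \<open>Bessel's inequality for the system \<open>w\<close>, applied to a row of
    \<open>Y\<close>; it yields \<open>c i \<le> 1\<close>.\<close>
  have rowb: "(\<Sum>j<k. (z i j)\<^sup>2 / N j) \<le> d i" if "i < m" for i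
    using bessel_inequality[of "{..<k}" "{..<n}" w "\<lambda>b. Y $$ (i, b)"] orth
    by (simp add: z_def N_def dsq[OF that] mult.commute)
  \<comment> \<open>The same inequality with the roles exchanged: the rows of \<open>Y\<close> form
    the system and \<open>w j\<close> is expanded. It bounds the total weight by
    \<open>k\<close>.\<close>
  have colb: "(\<Sum>i<m. (z i j)\<^sup>2 / d i) \<le> N j" for j
  proof -
    have "(\<Sum>i<m. (z i j)\<^sup>2 / d i) = (\<Sum>i<m. (z i j)\<^sup>2 / (\<Sum>b<n. (Y $$ (i, b))\<^sup>2))"
      by (rule sum.cong) (simp_all add: dsq)
    also have "\<dots> \<le> N j"
      unfolding z_def N_def by (rule bessel_inequality) (use Yrow in auto)
    finally show ?thesis .
  qed
  have c0: "0 \<le> c i" if "i < m" for i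
    using that d0 N0 by (simp add: c_def sum_nonneg)
  have c1: "c i \<le> 1" if "i < m" for i
    using that d0[OF that] rowb[OF that] by (cases "d i = 0") (simp_all add: c_def)
  have ck: "(\<Sum>i<m. c i) \<le> real k"
  proof -
    have "(\<Sum>i<m. c i) = (\<Sum>j<k. (\<Sum>i<m. (z i j)\<^sup>2 / d i) / N j)"
      unfolding c_def sum_divide_distrib
      by (subst sum.swap) (simp add: mult.commute)
    also have "\<dots> \<le> (\<Sum>j<k. 1)"
    proof (rule sum_mono)
      fix j
      show "(\<Sum>i<m. (z i j)\<^sup>2 / d i) / N j \<le> 1"
        using colb[of j] N0[of j] by (cases "N j = 0") simp_all
    qed
    finally show ?thesis
      by simp
  qed
  \<comment> \<open>When \<open>d i = 0\<close>, row \<open>i\<close> of \<open>Y\<close> has norm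
    0, so the right-hand side vanishes as well.\<close>
  have dc: "d i * c i = (\<Sum>j<k. (z i j)\<^sup>2 / N j)" if "i < m" for i
  proof (cases "d i = 0")
    case True
    then have "\<forall>b<n. Y $$ (i, b) = 0"
      using dsq[OF that] by (simp add: sum_nonneg_eq_0_iff)
    then show ?thesis
      using True by (simp add: z_def)
  qed (simp add: c_def)
  have ms: "mset xs = mset (map d [0..<m])" and so: "sorted (rev xs)"
    using proots_char_poly_diagonalizable[OF A P PAP]
    by (simp_all add: xs_def spectrum_list_def flip: A_def)
  have len: "length xs = m"
    using mset_eq_length[OF ms] by simp
  \<comment> \<open>\<open>p\<close> sorts the numbers \<open>d i\<close> into nonincreasing order.
    They are nonnegative, so padding with zeros keeps the sequence monotone.\<close>
  obtain p where p: "p permutes {..<m}" and pxs: "permute_list p (map d [0..<m]) = xs"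
    using mset_eq_permutation[OF ms] by auto
  have xsd: "xs ! i = d (p i)" and pm: "p i < m" if "i < m" for i
  proof -
    show "p i < m"
      using permutes_in_image[OF p, of i] that by simp
    then show "xs ! i = d (p i)"
      using that p by (simp add: permute_list_nth flip: pxs)
  qed
  define L where "L i = (if i < length xs then xs ! i else 0)" for i
  have "(\<Sum>j<k. (\<Sum>a<m. (\<Sum>b<n. B $$ (a, b) * w j b)\<^sup>2) / N j)
      \<le> (\<Sum>j<k. (\<Sum>i<m. (z i j)\<^sup>2) / N j)"
    by (rule sum_mono, rule divide_right_mono[OF le N0])
  also have "\<dots> = (\<Sum>i<m. \<Sum>j<k. (z i j)\<^sup>2 / N j)"
    unfolding sum_divide_distrib by (rule sum.swap)
  also have "\<dots> = (\<Sum>i<m. d i * c i)"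
    by (rule sum.cong) (simp_all add: dc)
  also have "\<dots> = (\<Sum>i<m. d (p i) * c (p i))"
    using sum.permute[OF p, of "\<lambda>i. d i * c i"] by (simp add: o_def)
  also have "\<dots> = (\<Sum>i<m. L i * c (p i))"
    by (rule sum.cong) (simp_all add: L_def xsd len)
  also have "\<dots> \<le> (\<Sum>i<k. L i)"
  proof (rule weighted_sum_le_sum_largest)
    show "0 \<le> L i" for i
      using d0 pm by (simp add: L_def len xsd)
    show "antimono L"
    proof (rule antimonoI)
      fix i j :: nat assume "i \<le> j"
      then show "L j \<le> L i"
        using so sorted_rev_nth_mono[of xs i j] \<open>0 \<le> L i\<close> by (auto simp: L_def)
    qed
    have "(\<Sum>i<m. c (p i)) = (\<Sum>i<m. c i)"
      using sum.permute[OF p, of c] by (simp add: o_def)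
    then show "(\<Sum>i<m. c (p i)) \<le> real k"
      using ck by simp
  qed (use c0 c1 pm in auto)
  finally show ?thesis
    by (simp add: N_def L_def)
qed


section \<open>Simplicial complexes and changes of orientation\<close>

lemma face_list:
  assumes "finite (faces i K)"
  shows "distinct (face_list i K)" and "set (face_list i K) = faces i K"
proof -
  have "\<exists>xs. distinct xs \<and> set xs = faces i K"
    using finite_distinct_list[OF assms] by blast
  from someI_ex[OF this]
  show "distinct (face_list i K)" "set (face_list i K) = faces i K"
    by (simp_all add: face_list_def)
qed

text \<open>Sums over faces replace sums over matrix indices, so the arbitrary choice of
  \<open>face_list\<close> disappears from the bound.\<close>

theorem ky_fan_up_laplacian:
  fixes K :: "'a set set" and w :: "nat \<Rightarrow> 'a set \<Rightarrow> real"
  assumes fin: "finite K"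
    and orth: "\<And>i j. i < k \<Longrightarrow> j < k \<Longrightarrow> i \<noteq> j \<Longrightarrow> (\<Sum>\<sigma>\<in>faces (Suc d) K. w i \<sigma> * w j \<sigma>) = 0"
  shows "(\<Sum>j<k. (\<Sum>\<tau>\<in>faces d K. (\<Sum>\<sigma>\<in>faces (Suc d) K. boundary_coeff ord \<tau> \<sigma> * w j \<sigma>)\<^sup>2)
              / (\<Sum>\<sigma>\<in>faces (Suc d) K. (w j \<sigma>)\<^sup>2))
           \<le> (\<Sum>i=1..k. up_eigenvalue ord d K i)"
proof -
  have finf: "finite (faces i K)" for i
    using fin by (simp add: faces_def)
  note fl = face_list[OF finf]
  have len: "length (face_list i K) = card (faces i K)" for i
    using distinct_card[OF fl(1)] fl(2) by metis
  have reindex: "(\<Sum>\<sigma>\<in>faces i K. g \<sigma>) = (\<Sum>b<card (faces i K). g (face_list i K ! b))"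
    for g :: "'a set \<Rightarrow> real" and i
    using sum.reindex_bij_betw[OF bij_betw_nth[OF fl(1) refl refl], of g i]
    by (simp add: fl(2) len)
  define B where "B = boundary_matrix ord (Suc d) K"
  have B: "B \<in> carrier_mat (card (faces d K)) (card (faces (Suc d) K))"
    by (simp add: B_def boundary_matrix_def)
  have entry: "B $$ (a, b) = boundary_coeff ord (face_list d K ! a) (face_list (Suc d) K ! b)"
    if "a < card (faces d K)" "b < card (faces (Suc d) K)" for a b
    using that by (simp add: B_def boundary_matrix_def)
  have "(\<Sum>j<k. (\<Sum>\<tau>\<in>faces d K. (\<Sum>\<sigma>\<in>faces (Suc d) K. boundary_coeff ord \<tau> \<sigma> * w j \<sigma>)\<^sup>2)
              / (\<Sum>\<sigma>\<in>faces (Suc d) K. (w j \<sigma>)\<^sup>2))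
    = (\<Sum>j<k. (\<Sum>a<card (faces d K).
          (\<Sum>b<card (faces (Suc d) K). B $$ (a, b) * w j (face_list (Suc d) K ! b))\<^sup>2)
              / (\<Sum>b<card (faces (Suc d) K). (w j (face_list (Suc d) K ! b))\<^sup>2))"
    by (simp add: reindex entry)
  also have "\<dots> \<le> (\<Sum>i<k. let xs = spectrum_list (B * transpose_mat B)
                          in if i < length xs then xs ! i else 0)"
    unfolding Let_def by (rule ky_fan_gram[OF B]) (use orth in \<open>simp add: reindex\<close>)
  also have "\<dots> = (\<Sum>i<k. up_eigenvalue ord d K (Suc i))"
    by (intro sum.cong refl) (auto simp: up_eigenvalue_def up_laplacian_def B_def Let_def)
  also have "\<dots> = (\<Sum>i=1..k. up_eigenvalue ord d K i)"
    by (simp add: sum.atLeast1_atMost_eq)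
  finally show ?thesis .
qed

section \<open>Orientations and sign changes\<close>

text \<open>Signs depend only on how two vertices of the same face compare. This notion also covers
  comparisons that tie vertices sharing no facet.\<close>

definition tournament_on :: "'a set \<Rightarrow> 'a rel \<Rightarrow> bool" where
  "tournament_on \<sigma> R \<longleftrightarrow> (\<forall>u\<in>\<sigma>. \<forall>w\<in>\<sigma>. u \<noteq> w \<longrightarrow> ((u, w) \<in> R \<longleftrightarrow> (w, u) \<notin> R))"

lemma tournament_onD:
  "tournament_on \<sigma> R \<Longrightarrow> u \<in> \<sigma> \<Longrightarrow> w \<in> \<sigma> \<Longrightarrow> u \<noteq> w \<Longrightarrow> (u, w) \<in> R \<longleftrightarrow> (w, u) \<notin> R"
  unfolding tournament_on_def by blast

lemma tournament_on_linear_order: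
  assumes "linear_order_on V R" and "\<sigma> \<subseteq> V"
  shows "tournament_on \<sigma> R"
  unfolding tournament_on_def
proof (intro ballI impI)
  fix u w assume uw: "u \<in> \<sigma>" "w \<in> \<sigma>" "u \<noteq> w"
  have "antisym R" and "total_on V R"
    using assms(1) by (auto simp: linear_order_on_def partial_order_on_def)
  moreover have "u \<in> V" "w \<in> V"
    using uw assms(2) by auto
  ultimately show "(u, w) \<in> R \<longleftrightarrow> (w, u) \<notin> R"
    using uw(3) antisymD[of R u w] unfolding total_on_def by auto
qed

text \<open>For two tournaments, every pair of vertices on which they disagree lies in
  \<open>R - R'\<close> in exactly one direction and is counted once.\<close>

definition inversions :: "'a rel \<Rightarrow> 'a rel \<Rightarrow> 'a set \<Rightarrow> nat" where
  "inversions R R' \<sigma> = card {(u, w) \<in> \<sigma> \<times> \<sigma>. u \<noteq> w \<and> (u, w) \<in> R - R'}"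

text \<open>Deleting \<open>x\<close> loses the inversions that involve \<open>x\<close>, in number
  \<open>|D1| + |D2|\<close>, while passing from \<open>R'\<close> to \<open>R\<close> moves the
  position of \<open>x\<close> by \<open>|D1| - |D2|\<close>. Both have the same parity.\<close>

lemma position_parity:
  assumes fin: "finite \<sigma>" and x: "x \<in> \<sigma>" and R: "tournament_on \<sigma> R" and R': "tournament_on \<sigma> R'"
  shows "even (position R \<sigma> x + position R' \<sigma> x + inversions R R' \<sigma> + inversions R R' (\<sigma> - {x}))"
proof -
  define D1 where "D1 = {u \<in> \<sigma>. u \<noteq> x \<and> (u, x) \<in> R - R'}"
  define D2 where "D2 = {u \<in> \<sigma>. u \<noteq> x \<and> (u, x) \<in> R' - R}"
  define I where "I = {(u, w) \<in> (\<sigma> - {x}) \<times> (\<sigma> - {x}). u \<noteq> w \<and> (u, w) \<in> R - R'}"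
  have finI: "finite I"
    by (rule finite_subset[of _ "\<sigma> \<times> \<sigma>"]) (use fin in \<open>auto simp: I_def\<close>)
  have D2': "D2 = {u \<in> \<sigma>. u \<noteq> x \<and> (x, u) \<in> R - R'}"
  proof -
    have "(u, x) \<in> R' - R \<longleftrightarrow> (x, u) \<in> R - R'" if "u \<in> \<sigma>" "u \<noteq> x" for u
      using tournament_onD[OF R that(1) x that(2)] tournament_onD[OF R' that(1) x that(2)]
      by (simp only: Diff_iff) argo
    then show ?thesis
      unfolding D2_def by (intro Collect_cong) meson
  qed
  have "{(u, w) \<in> \<sigma> \<times> \<sigma>. u \<noteq> w \<and> (u, w) \<in> R - R'} = I \<union> (\<lambda>u. (u, x)) ` D1 \<union> (\<lambda>u. (x, u)) ` D2"
    using x by (auto simp: I_def D1_def D2')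
  moreover have "card (I \<union> (\<lambda>u. (u, x)) ` D1 \<union> (\<lambda>u. (x, u)) ` D2)
      = card (I \<union> (\<lambda>u. (u, x)) ` D1) + card ((\<lambda>u. (x, u)) ` D2)"
    by (rule card_Un_disjoint) (use fin finI in \<open>auto simp: I_def D1_def D2_def\<close>)
  moreover have "card (I \<union> (\<lambda>u. (u, x)) ` D1) = card I + card ((\<lambda>u. (u, x)) ` D1)"
    by (rule card_Un_disjoint) (use fin finI in \<open>auto simp: I_def D1_def\<close>)
  ultimately have 1: "inversions R R' \<sigma> = inversions R R' (\<sigma> - {x}) + card D1 + card D2"
    by (simp add: inversions_def I_def card_image inj_on_def)
  have "position R \<sigma> x + card D2 = card ({u \<in> \<sigma>. u \<noteq> x \<and> (u, x) \<in> R} \<union> D2)"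
    unfolding position_def by (rule card_Un_disjoint[symmetric]) (use fin in \<open>auto simp: D2_def\<close>)
  also have "\<dots> = card ({u \<in> \<sigma>. u \<noteq> x \<and> (u, x) \<in> R'} \<union> D1)"
    by (rule arg_cong[of _ _ card]) (auto simp: D1_def D2_def)
  also have "\<dots> = position R' \<sigma> x + card D1"
    unfolding position_def by (rule card_Un_disjoint) (use fin in \<open>auto simp: D1_def\<close>)
  finally have 2: "position R \<sigma> x + card D2 = position R' \<sigma> x + card D1" .
  \<comment> \<open>Adding the two equations cancels \<open>d2\<close> and leaves an even
    total.\<close>
  have "p + p' + i + i' = 2 * (p' + d1 + i')" if "p + d2 = p' + d1" "i = i' + d1 + d2"
    for p p' d1 d2 i i' :: nat
    using that by simp
  from this[OF 2 1] show ?thesis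
    by (simp only: dvd_triv_left)
qed

text \<open>A change of order multiplies the rows and columns of the boundary matrix by signs.
  Energies can thus be computed in a convenient order once the signs of the test vectors are
  adjusted.\<close>

lemma boundary_coeff_change_order:
  assumes "finite \<sigma>" and "tournament_on \<sigma> R" and "tournament_on \<sigma> R'"
  shows "boundary_coeff R \<tau> \<sigma>
           = (- 1) ^ inversions R R' \<tau> * (- 1) ^ inversions R R' \<sigma> * boundary_coeff R' \<tau> \<sigma>"
  unfolding boundary_coeff_def sum_distrib_left
proof (rule sum.cong[OF refl])
  fix x assume x: "x \<in> \<sigma>"
  have "(- 1 :: real) ^ position R \<sigma> x
      = (- 1) ^ inversions R R' (\<sigma> - {x}) * (- 1) ^ inversions R R' \<sigma> * (- 1) ^ position R' \<sigma> x"
    using position_parity[OF assms(1) x assms(2,3)]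
    unfolding even_add minus_one_power_iff
    by (cases "even (position R \<sigma> x)"; cases "even (position R' \<sigma> x)";
        cases "even (inversions R R' \<sigma>)") (simp_all only: if_True if_False simp_thms mult_1 mult_minus1 minus_minus)
  then show "(if \<tau> = \<sigma> - {x} then (- 1) ^ position R \<sigma> x else 0)
      = (- 1) ^ inversions R R' \<tau> * (- 1) ^ inversions R R' \<sigma>
          * (if \<tau> = \<sigma> - {x} then (- 1) ^ position R' \<sigma> x else (0 :: real))"
    by (cases "\<tau> = \<sigma> - {x}") (simp_all only: if_True if_False mult_zero_right simp_thms)
qed

lemma boundary_coeff_remove:
  assumes "finite \<sigma>" and "x \<in> \<sigma>"
  shows "boundary_coeff R (\<sigma> - {x}) \<sigma> = (- 1) ^ position R \<sigma> x"
proof -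
  have "boundary_coeff R (\<sigma> - {x}) \<sigma> = (\<Sum>y\<in>\<sigma>. if y = x then (- 1) ^ position R \<sigma> x else 0)"
    unfolding boundary_coeff_def using assms by (intro sum.cong) auto
  then show ?thesis
    using assms by simp
qed

lemma boundary_coeff_eq_0: "(\<And>x. x \<in> \<sigma> \<Longrightarrow> \<tau> \<noteq> \<sigma> - {x}) \<Longrightarrow> boundary_coeff R \<tau> \<sigma> = 0"
  unfolding boundary_coeff_def by (rule sum.neutral) simp

section \<open>Complexes generated by sets of equal size\<close>

lemma faces_generated_complex:
  assumes "\<And>\<sigma>. \<sigma> \<in> F \<Longrightarrow> finite \<sigma> \<and> card \<sigma> = Suc d"
  shows "faces d (generated_complex F) = F"
proof
  show "faces d (generated_complex F) \<subseteq> F"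
  proof
    fix \<tau> assume "\<tau> \<in> faces d (generated_complex F)"
    then obtain \<sigma> where \<sigma>: "\<sigma> \<in> F" "\<tau> \<subseteq> \<sigma>" "card \<tau> = Suc d"
      by (auto simp: faces_def generated_complex_def)
    then show "\<tau> \<in> F"
      using card_subset_eq[of \<sigma> \<tau>] assms[of \<sigma>] by simp
  qed
qed (use assms in \<open>auto simp: faces_def generated_complex_def\<close>)

lemma pure_generated_complex:
  assumes "finite F" and "F \<noteq> {}" and card: "\<And>\<sigma>. \<sigma> \<in> F \<Longrightarrow> finite \<sigma> \<and> card \<sigma> = Suc d"
  shows "pure_complex d (generated_complex F)"
proof -
  have "simplicial_complex (generated_complex F)"
    unfolding simplicial_complex_def
  proof
    show "finite (\<Union> (generated_complex F))"
      by (rule finite_subset[of _ "\<Union> F"]) (use assms in \<open>auto simp: generated_complex_def\<close>)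
  qed (auto simp: generated_complex_def)
  moreover have "facets (generated_complex F) \<subseteq> F"
    by (auto simp: facets_def generated_complex_def)
  moreover have "F \<subseteq> generated_complex F"
    by (auto simp: generated_complex_def)
  ultimately show ?thesis
    using \<open>F \<noteq> {}\<close> card unfolding pure_complex_def by (metis Suc_eq_plus1 subset_empty subsetD)
qed

lemma finite_generated_complex:
  assumes "finite F" and "\<And>\<sigma>. \<sigma> \<in> F \<Longrightarrow> finite \<sigma>"
  shows "finite (generated_complex F)"
  by (rule finite_subset[of _ "Pow (\<Union> F)"]) (use assms in \<open>auto simp: generated_complex_def\<close>)

lemma dimension_generated_complex:
  assumes "finite F" and "F \<noteq> {}" and card: "\<And>\<sigma>. \<sigma> \<in> F \<Longrightarrow> finite \<sigma> \<and> card \<sigma> = Suc d"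
  shows "dimension (generated_complex F) = d"
proof -
  have "Max (card ` generated_complex F) = Suc d"
  proof (rule Max_eqI)
    show "finite (card ` generated_complex F)"
      using assms by (simp add: finite_generated_complex)
    show "Suc d \<in> card ` generated_complex F"
    proof -
      obtain \<sigma> where "\<sigma> \<in> F"
        using \<open>F \<noteq> {}\<close> by blast
      then have "\<sigma> \<in> generated_complex F" and "card \<sigma> = Suc d"
        using card by (auto simp: generated_complex_def)
      then show ?thesis
        by (metis image_eqI)
    qed
    fix y assume "y \<in> card ` generated_complex F"
    then obtain \<tau> \<sigma> where "\<sigma> \<in> F" "\<tau> \<subseteq> \<sigma>" "y = card \<tau>"
      by (auto simp: generated_complex_def)
    then show "y \<le> Suc d"
      using card[of \<sigma>] card_mono[of \<sigma> \<tau>] by simp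
  qed
  then show ?thesis
    by (simp add: dimension_def)
qed

lemma vertices_generated_complex: "vertices (generated_complex F) = \<Union> F"
  by (auto simp: vertices_def generated_complex_def)


section \<open>Cones over triangles\<close>

fun verts :: "'a \<times> 'a \<times> 'a \<Rightarrow> 'a set" where
  "verts (a, b, c) = {a, b, c}"

text \<open>The coefficient of \<open>[p, q]\<close> in the boundary
  \<open>[b, c] - [a, c] + [a, b]\<close> of \<open>[a, b, c]\<close>. With the edge fixed, it is
  the signed star of that edge as a vector on the triangles.\<close>

fun edge_coeff :: "'a \<times> 'a \<Rightarrow> 'a \<times> 'a \<times> 'a \<Rightarrow> int" where
  "edge_coeff (p, q) (a, b, c) =
     of_bool (p = b \<and> q = c) - of_bool (p = a \<and> q = c) + of_bool (p = a \<and> q = b)"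

text \<open>The triples are increasing for \<open>key\<close> and the apex set \<open>A\<close> comes last. The key need not be
  injective on all vertices, only on every facet.\<close>
locale coned_triangles =
  fixes T :: "('a \<times> 'a \<times> 'a) set" and A :: "'a set" and key :: "'a \<Rightarrow> nat"
  assumes finite_T: "finite T" and finite_A: "finite A"
    and key_T: "(a, b, c) \<in> T \<Longrightarrow> key a < key b \<and> key b < key c"
    and key_A: "(a, b, c) \<in> T \<Longrightarrow> x \<in> A \<Longrightarrow> key c < key x"
    and inj_A: "inj_on key A"
begin

definition facet :: "'a \<times> 'a \<times> 'a \<Rightarrow> 'a set" where
  "facet t = A \<union> verts t"

definition cone :: "'a set set" where
  "cone = generated_complex (facet ` T)"

definition key_order :: "'a rel" where
  "key_order = {(u, w). key u \<le> key w}"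

lemma notin_A: "(a, b, c) \<in> T \<Longrightarrow> a \<notin> A \<and> b \<notin> A \<and> c \<notin> A"
  using key_A key_T by (meson less_asym less_trans)

lemma facet_card: "t \<in> T \<Longrightarrow> finite (facet t) \<and> card (facet t) = Suc (Suc (Suc (card A)))"
proof -
  assume "t \<in> T"
  moreover obtain a b c where "t = (a, b, c)"
    by (cases t)
  moreover from calculation have "a \<noteq> b" "a \<noteq> c" "b \<noteq> c"
    using key_T[of a b c] by auto
  ultimately show ?thesis
    using notin_A[of a b c] finite_A by (simp add: facet_def)
qed

text \<open>Removing the disjoint set \<open>A\<close> recovers the three vertices, and their
  increasing keys recover the triple.\<close>

lemma inj_facet: "inj_on facet T"
proof (rule inj_onI)
  fix t t' assume T: "t \<in> T" "t' \<in> T" and eq: "facet t = facet t'"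
  obtain a b c a' b' c' where t: "t = (a, b, c)" "t' = (a', b', c')"
    by (cases t, cases t')
  have "A \<inter> verts t = {}" "A \<inter> verts t' = {}"
    using notin_A T by (auto simp: t)
  then have "verts t = verts t'"
    using eq unfolding facet_def by blast
  then have e: "{a, b, c} = {a', b', c'}"
    by (simp add: t)
  have "a \<in> {a', b', c'}" "b \<in> {a', b', c'}" "c \<in> {a', b', c'}"
    "a' \<in> {a, b, c}" "b' \<in> {a, b, c}" "c' \<in> {a, b, c}"
    using e by blast+
  then show "t = t'"
    using key_T[of a b c] key_T[of a' b' c'] T by (auto simp: t)
qed

lemma facets_of_cone: "faces (Suc (Suc (card A))) cone = facet ` T"
  unfolding cone_def by (rule faces_generated_complex) (use facet_card in auto)

lemma tournament_key_order: "t \<in> T \<Longrightarrow> tournament_on (facet t) key_order"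
proof -
  assume T: "t \<in> T"
  obtain a b c where t: "t = (a, b, c)"
    by (cases t)
  note abc = key_T[OF T[unfolded t]] key_A[OF T[unfolded t]]
  have ne: "key u \<noteq> key w" if uw: "u \<in> facet t" "w \<in> facet t" "u \<noteq> w" for u w
  proof -
    consider "u \<in> A" "w \<in> A" | "u \<in> A" "w \<in> {a, b, c}" | "u \<in> {a, b, c}" "w \<in> A"
      | "u \<in> {a, b, c}" "w \<in> {a, b, c}"
      using uw by (auto simp: facet_def t)
    then show ?thesis
    proof cases
      case 1
      then show ?thesis
        using inj_onD[OF inj_A] uw(3) by blast
    next
      case 2
      then show ?thesis
        using abc(1) abc(2)[of u] by auto
    next
      case 3
      then show ?thesis
        using abc(1) abc(2)[of w] by auto
    next
      case 4
      then show ?thesis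
        using abc(1) uw(3) by auto
    qed
  qed
  show ?thesis
    unfolding tournament_on_def
  proof (intro ballI impI)
    fix u w assume "u \<in> facet t" "w \<in> facet t" "u \<noteq> w"
    then show "(u, w) \<in> key_order \<longleftrightarrow> (w, u) \<notin> key_order"
      using ne[of u w] by (simp add: key_order_def) linarith
  qed
qed

lemma apex_pair_eq:
  assumes "A \<union> {p, q} = A \<union> {u, w}" and "{p, q, u, w} \<inter> A = {}"
    and "key p < key q" and "key u < key w"
  shows "p = u \<and> q = w"
proof -
  have "{p, q} = {u, w}"
    using assms(1,2) by blast
  then show ?thesis
    using assms(3,4) by (auto simp: doubleton_eq_iff)
qed

lemma position_key_order:
  "position key_order \<sigma> x = card {u \<in> \<sigma>. u \<noteq> x \<and> key u \<le> key x}"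
  by (simp add: position_def key_order_def)

text \<open>All apexes come after \<open>a\<close>, \<open>b\<close>, \<open>c\<close>, which
  therefore keep the positions 0, 1, 2. The signs are those of the boundary of the bare
  triangle.\<close>

lemma coeff_edge:
  assumes T: "t \<in> T" and pq: "key p < key q" "p \<notin> A" "q \<notin> A"
  shows "boundary_coeff key_order (A \<union> {p, q}) (facet t) = real_of_int (edge_coeff (p, q) t)"
proof -
  obtain a b c where t: "t = (a, b, c)"
    by (cases t)
  note abc = key_T[OF T[unfolded t]] notin_A[OF T[unfolded t]]
  have fin: "finite (facet t)"
    using facet_card[OF T] by blast
  have mem: "a \<in> facet t" "b \<in> facet t" "c \<in> facet t"
    by (auto simp: facet_def t)
  have above: "key a < key x" "key b < key x" "key c < key x" if "x \<in> A" for x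
    using key_A[of a b c x] T that abc by (auto simp: t)
  have "{u \<in> facet t. u \<noteq> a \<and> key u \<le> key a} = {}"
    using abc by (auto simp: facet_def t dest: above)
  then have pa: "position key_order (facet t) a = 0"
    unfolding position_key_order by (simp only:) simp
  have "{u \<in> facet t. u \<noteq> b \<and> key u \<le> key b} = {a}"
    using abc by (auto simp: facet_def t dest: above)
  then have pb: "position key_order (facet t) b = 1"
    unfolding position_key_order by (simp only:) simp
  have "{u \<in> facet t. u \<noteq> c \<and> key u \<le> key c} = {a, b}"
    using abc by (auto simp: facet_def t dest: above)
  moreover have "a \<noteq> b"
    using abc by auto
  ultimately have pc: "position key_order (facet t) c = 2"
    unfolding position_key_order by (simp only:) simp
  have rem: "facet t - {a} = A \<union> {b, c}" "facet t - {b} = A \<union> {a, c}" "facet t - {c} = A \<union> {a, b}"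
    using abc by (auto simp: facet_def t)
  have val: "boundary_coeff key_order (A \<union> {b, c}) (facet t) = 1"
    "boundary_coeff key_order (A \<union> {a, c}) (facet t) = - 1"
    "boundary_coeff key_order (A \<union> {a, b}) (facet t) = 1"
    using boundary_coeff_remove[OF fin mem(1), of key_order] boundary_coeff_remove[OF fin mem(2), of key_order]
      boundary_coeff_remove[OF fin mem(3), of key_order]
    unfolding rem pa pb pc by simp_all
  consider "p = b" "q = c" | "p = a" "q = c" | "p = a" "q = b"
    | "\<not> (p = b \<and> q = c)" "\<not> (p = a \<and> q = c)" "\<not> (p = a \<and> q = b)"
    by blast
  then show ?thesis
  proof cases
    case 1
    then have "edge_coeff (p, q) t = 1"
      using abc by (auto simp: t)
    then show ?thesis
      unfolding 1 val by simp
  next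
    case 2
    then have "edge_coeff (p, q) t = - 1"
      using abc by (auto simp: t)
    then show ?thesis
      unfolding 2 val by simp
  next
    case 3
    then have "edge_coeff (p, q) t = 1"
      using abc by (auto simp: t)
    then show ?thesis
      unfolding 3 val by simp
  next
    case 4
    have "boundary_coeff key_order (A \<union> {p, q}) (facet t) = 0"
    proof (rule boundary_coeff_eq_0)
      fix x assume "x \<in> facet t"
      then consider (A) "x \<in> A" | (a) "x = a" | (b) "x = b" | (c) "x = c"
        by (auto simp: facet_def t)
      then show "A \<union> {p, q} \<noteq> facet t - {x}"
      proof cases
        case A
        then show ?thesis by blast
      next
        case a
        show ?thesis
          unfolding a rem using apex_pair_eq[of p q b c] pq abc 4(1) by blast
      next
        case b
        show ?thesis
          unfolding b rem using apex_pair_eq[of p q a c] pq abc less_trans[of "key a" "key b" "key c"] 4(2) by blast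
      next
        case c
        show ?thesis
          unfolding c rem using apex_pair_eq[of p q a b] pq abc 4(3) by blast
      qed
    qed
    then show ?thesis
      using 4 by (auto simp: t)
  qed
qed

text \<open>Every facet contains \<open>y\<close>, so another facet can produce
  \<open>facet t - {y}\<close> only by losing \<open>y\<close> itself, which forces it to be
  \<open>facet t\<close>. The row of such a ridge has a single nonzero entry.\<close>

lemma coeff_link:
  assumes T: "t \<in> T" "t' \<in> T" and y: "y \<in> A"
  shows "boundary_coeff key_order (facet t - {y}) (facet t')
           = (if t' = t then (- 1) ^ position key_order (facet t) y else 0)"
proof (cases "t' = t")
  case True
  then show ?thesis
    using boundary_coeff_remove[of "facet t" y] facet_card[OF T(1)] y by (simp add: facet_def)
next
  case False
  have "boundary_coeff key_order (facet t - {y}) (facet t') = 0"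
  proof (rule boundary_coeff_eq_0)
    fix x assume x: "x \<in> facet t'"
    show "facet t - {y} \<noteq> facet t' - {x}"
    proof
      assume eq: "facet t - {y} = facet t' - {x}"
      have y': "y \<in> facet t" "y \<in> facet t'"
        using y by (auto simp: facet_def)
      then have "x = y"
        using eq by blast
      then have "facet t = facet t'"
        using eq y' by blast
      then show False
        using False inj_onD[OF inj_facet] T by blast
    qed
  qed
  then show ?thesis
    using False by simp
qed

section \<open>Test vectors on a cone\<close>

text \<open>The sign carries a vector chosen for the orientation \<open>key_order\<close> over to
  the orientation \<open>ord\<close>.\<close>

definition weight :: "'a rel \<Rightarrow> ('a \<times> 'a \<times> 'a \<Rightarrow> int) \<Rightarrow> 'a set \<Rightarrow> real" where
  "weight ord W \<sigma> = (- 1) ^ inversions ord key_order \<sigma> * of_int (W (the_inv_into T facet \<sigma>))"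

lemma weight_facet:
  "t \<in> T \<Longrightarrow> weight ord W (facet t) = (- 1) ^ inversions ord key_order (facet t) * of_int (W t)"
  by (simp add: weight_def the_inv_into_f_f[OF inj_facet])

lemma sum_weight_mult:
  "(\<Sum>\<sigma>\<in>facet ` T. weight ord W \<sigma> * weight ord W' \<sigma>) = of_int (\<Sum>t\<in>T. W t * W' t)"
  by (simp add: sum.reindex[OF inj_facet] weight_facet algebra_simps flip: power_add)

text \<open>Ridges of the form \<open>A\<close> plus an edge give the energy on the bare triangles;
  ridges of the form facet minus an apex give \<open>(W t)\<^sup>2\<close> once for every apex. All
  remaining ridges contribute squares, whence an inequality.\<close>

lemma boundary_energy:
  assumes ord: "\<And>t. t \<in> T \<Longrightarrow> tournament_on (facet t) ord"
    and E: "finite E" "\<And>p q. (p, q) \<in> E \<Longrightarrow> key p < key q \<and> p \<notin> A \<and> q \<notin> A \<and> (\<exists>t\<in>T. {p, q} \<subseteq> verts t)"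
  shows "of_int ((\<Sum>e\<in>E. (\<Sum>t\<in>T. edge_coeff e t * W t)\<^sup>2) + int (card A) * (\<Sum>t\<in>T. (W t)\<^sup>2))
    \<le> (\<Sum>\<tau>\<in>faces (Suc (card A)) cone. (\<Sum>\<sigma>\<in>facet ` T. boundary_coeff ord \<tau> \<sigma> * weight ord W \<sigma>)\<^sup>2)"
proof -
  define h where "h \<tau> = (\<Sum>t\<in>T. boundary_coeff key_order \<tau> (facet t) * of_int (W t))\<^sup>2" for \<tau>
  have h: "(\<Sum>\<sigma>\<in>facet ` T. boundary_coeff ord \<tau> \<sigma> * weight ord W \<sigma>)\<^sup>2 = h \<tau>" for \<tau>
  proof -
    have "(\<Sum>\<sigma>\<in>facet ` T. boundary_coeff ord \<tau> \<sigma> * weight ord W \<sigma>)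
        = (\<Sum>t\<in>T. (- 1) ^ inversions ord key_order \<tau>
              * (boundary_coeff key_order \<tau> (facet t) * of_int (W t)))"
      unfolding sum.reindex[OF inj_facet] o_def
    proof (rule sum.cong[OF refl])
      fix t assume t: "t \<in> T"
      have "((- 1 :: real) ^ inversions ord key_order (facet t)) * (- 1) ^ inversions ord key_order (facet t) = 1"
        by (simp flip: power_add mult_2)
      then show "boundary_coeff ord \<tau> (facet t) * weight ord W (facet t)
          = (- 1) ^ inversions ord key_order \<tau> * (boundary_coeff key_order \<tau> (facet t) * of_int (W t))"
        using boundary_coeff_change_order[of "facet t" ord key_order \<tau>] facet_card[OF t] ord[OF t]
          tournament_key_order[OF t] weight_facet[OF t]
        by (simp add: algebra_simps)
    qed
    then show ?thesis
      by (simp add: h_def power_mult_distrib flip: sum_distrib_left power_mult)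
  qed
  define F1 where "F1 = (\<lambda>(p, q). A \<union> {p, q}) ` E"
  define F2 where "F2 = (\<lambda>(t, y). facet t - {y}) ` (T \<times> A)"
  have fin: "finite F1" "finite F2"
    using E finite_T finite_A by (auto simp: F1_def F2_def)
  have "finite cone"
    unfolding cone_def by (rule finite_generated_complex) (use finite_T facet_card in auto)
  then have finf: "finite (faces (Suc (card A)) cone)"
    by (simp add: faces_def)
  have sub1: "F1 \<subseteq> faces (Suc (card A)) cone"
  proof
    fix \<tau> assume "\<tau> \<in> F1"
    then obtain p q where pq: "(p, q) \<in> E" "\<tau> = A \<union> {p, q}"
      by (auto simp: F1_def)
    then have "p \<noteq> q" "p \<notin> A" "q \<notin> A"
      using E(2)[of p q] by auto
    then have "card \<tau> = Suc (Suc (card A))"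
      using finite_A by (simp add: pq)
    moreover obtain t where "t \<in> T" "{p, q} \<subseteq> verts t"
      using E(2)[OF pq(1)] by blast
    then have "\<tau> \<in> cone"
      unfolding cone_def generated_complex_def facet_def pq by blast
    ultimately show "\<tau> \<in> faces (Suc (card A)) cone"
      by (simp add: faces_def)
  qed
  have sub2: "F2 \<subseteq> faces (Suc (card A)) cone"
  proof
    fix \<tau> assume "\<tau> \<in> F2"
    then obtain t y where ty: "t \<in> T" "y \<in> A" "\<tau> = facet t - {y}"
      by (auto simp: F2_def)
    then have "y \<in> facet t"
      by (simp add: facet_def)
    then have "card \<tau> = Suc (Suc (card A))"
      using facet_card[OF ty(1)] by (simp add: ty)
    moreover have "\<tau> \<in> cone"
      using ty unfolding cone_def generated_complex_def by blast
    ultimately show "\<tau> \<in> faces (Suc (card A)) cone"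
      by (simp add: faces_def)
  qed
  \<comment> \<open>Sets in \<open>F1\<close> contain all of \<open>A\<close>, while those in
    \<open>F2\<close> lack an apex.\<close>
  have disj: "F1 \<inter> F2 = {}"
    by (auto simp: F1_def F2_def)
  have inj1: "inj_on (\<lambda>(p, q). A \<union> {p, q}) E"
  proof (rule inj_onI, clarify)
    fix p q p' q' assume e: "(p, q) \<in> E" "(p', q') \<in> E" "A \<union> {p, q} = A \<union> {p', q'}"
    then show "p = p' \<and> q = q'"
      using apex_pair_eq[of p q p' q'] E(2)[OF e(1)] E(2)[OF e(2)] by blast
  qed
  have inj2: "inj_on (\<lambda>(t, y). facet t - {y}) (T \<times> A)"
  proof (rule inj_onI, clarify)
    fix t y t' y' assume e: "t \<in> T" "y \<in> A" "t' \<in> T" "y' \<in> A" "facet t - {y} = facet t' - {y'}"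
    have m: "y \<in> facet t" "y \<in> facet t'" "y' \<in> facet t" "y' \<in> facet t'"
      using e by (auto simp: facet_def)
    then have "y = y'"
      using e by blast
    moreover have "facet t = facet t'"
      using e m \<open>y = y'\<close> by blast
    ultimately show "t = t' \<and> y = y'"
      using inj_onD[OF inj_facet] e by blast
  qed
  have h1: "h (A \<union> {p, q}) = of_int ((\<Sum>t\<in>T. edge_coeff (p, q) t * W t)\<^sup>2)" if "(p, q) \<in> E" for p q
  proof -
    have "(\<Sum>t\<in>T. boundary_coeff key_order (A \<union> {p, q}) (facet t) * of_int (W t))
        = of_int (\<Sum>t\<in>T. edge_coeff (p, q) t * W t)"
      unfolding of_int_sum of_int_mult
      by (intro sum.cong refl arg_cong2[of _ _ _ _ "(*)"] coeff_edge) (use E(2)[OF that] in auto)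
    then show ?thesis
      by (simp only: h_def of_int_power)
  qed
  have h2: "h (facet t - {y}) = of_int ((W t)\<^sup>2)" if "t \<in> T" "y \<in> A" for t y
  proof -
    have "(\<Sum>t'\<in>T. boundary_coeff key_order (facet t - {y}) (facet t') * of_int (W t'))
      = (\<Sum>t'\<in>T. if t' = t then (- 1) ^ position key_order (facet t) y * of_int (W t) else 0)"
      by (rule sum.cong) (auto simp: coeff_link that)
    then show ?thesis
      using that finite_T by (simp add: h_def power_mult_distrib flip: power_mult)
  qed
  have "(\<Sum>\<tau>\<in>F1. h \<tau>) = (\<Sum>e\<in>E. of_int ((\<Sum>t\<in>T. edge_coeff e t * W t)\<^sup>2))"
    unfolding F1_def sum.reindex[OF inj1]
    by (rule sum.cong) (auto simp only: h1 o_def split_beta prod.collapse fst_conv snd_conv)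
  moreover have "(\<Sum>\<tau>\<in>F2. h \<tau>) = (\<Sum>(t, y)\<in>T \<times> A. of_int ((W t)\<^sup>2))"
    unfolding F2_def sum.reindex[OF inj2] by (rule sum.cong) (auto simp: h2)
  moreover have "(\<Sum>(t, y)\<in>T \<times> A. real_of_int ((W t)\<^sup>2)) = real (card A) * (\<Sum>t\<in>T. real_of_int ((W t)\<^sup>2))"
    by (simp add: sum.cartesian_product[symmetric] sum_distrib_left)
  moreover have "(\<Sum>\<tau>\<in>F1. h \<tau>) + (\<Sum>\<tau>\<in>F2. h \<tau>) = (\<Sum>\<tau>\<in>F1 \<union> F2. h \<tau>)"
    by (rule sum.union_disjoint[OF fin disj, symmetric])
  moreover have "(\<Sum>\<tau>\<in>F1 \<union> F2. h \<tau>) \<le> (\<Sum>\<tau>\<in>faces (Suc (card A)) cone. h \<tau>)"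
    by (rule sum_mono2) (use finf sub1 sub2 in \<open>auto simp: h_def\<close>)
  ultimately show ?thesis
    unfolding h by simp
qed

text \<open>Dividing \<open>boundary_energy\<close> by the squared norm turns the contribution of
  the apexes into exactly \<open>card A\<close> for each test vector; Ky Fan's principle does the
  rest.\<close>

theorem sum_up_eigenvalue_ge:
  fixes W :: "nat \<Rightarrow> 'a \<times> 'a \<times> 'a \<Rightarrow> int"
  assumes ord: "\<And>t. t \<in> T \<Longrightarrow> tournament_on (facet t) ord"
    and E: "finite E" "\<And>p q. (p, q) \<in> E \<Longrightarrow> key p < key q \<and> p \<notin> A \<and> q \<notin> A \<and> (\<exists>t\<in>T. {p, q} \<subseteq> verts t)"
    and orth: "\<And>i j. i < k \<Longrightarrow> j < k \<Longrightarrow> i \<noteq> j \<Longrightarrow> (\<Sum>t\<in>T. W i t * W j t) = 0"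
    and W0: "\<And>j. j < k \<Longrightarrow> (\<Sum>t\<in>T. (W j t)\<^sup>2) \<noteq> 0"
  shows "real k * real (card A)
      + (\<Sum>j<k. of_int (\<Sum>e\<in>E. (\<Sum>t\<in>T. edge_coeff e t * W j t)\<^sup>2) / of_int (\<Sum>t\<in>T. (W j t)\<^sup>2))
    \<le> (\<Sum>i=1..k. up_eigenvalue ord (Suc (card A)) cone i)"
proof -
  have "finite cone"
    unfolding cone_def by (rule finite_generated_complex) (use finite_T facet_card in auto)
  have sq: "(\<Sum>\<sigma>\<in>facet ` T. (weight ord (W j) \<sigma>)\<^sup>2) = of_int (\<Sum>t\<in>T. (W j t)\<^sup>2)" for j
    using sum_weight_mult[of ord "W j" "W j"] by (simp add: power2_eq_square)
  have "real (card A)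
      + of_int (\<Sum>e\<in>E. (\<Sum>t\<in>T. edge_coeff e t * W j t)\<^sup>2) / of_int (\<Sum>t\<in>T. (W j t)\<^sup>2)
    \<le> (\<Sum>\<tau>\<in>faces (Suc (card A)) cone. (\<Sum>\<sigma>\<in>facet ` T. boundary_coeff ord \<tau> \<sigma> * weight ord (W j) \<sigma>)\<^sup>2)
        / (\<Sum>\<sigma>\<in>facet ` T. (weight ord (W j) \<sigma>)\<^sup>2)" if "j < k" for j
  proof -
    define N where "N = (\<Sum>t\<in>T. (W j t)\<^sup>2)"
    define Q where "Q = (\<Sum>e\<in>E. (\<Sum>t\<in>T. edge_coeff e t * W j t)\<^sup>2)"
    have "N > 0"
      using W0[OF that] by (simp add: N_def order_less_le sum_nonneg)
    then have "real (card A) + of_int Q / of_int N = of_int (Q + int (card A) * N) / of_int N"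
      by (simp add: add_divide_distrib)
    also have "\<dots> \<le> (\<Sum>\<tau>\<in>faces (Suc (card A)) cone.
        (\<Sum>\<sigma>\<in>facet ` T. boundary_coeff ord \<tau> \<sigma> * weight ord (W j) \<sigma>)\<^sup>2) / of_int N"
      unfolding Q_def N_def using boundary_energy[OF ord E, of "W j"] \<open>N > 0\<close>
      by (intro divide_right_mono) (simp_all add: N_def sum_nonneg)
    finally show ?thesis
      unfolding sq by (simp only: N_def Q_def)
  qed
  then have "(\<Sum>j<k. real (card A)
      + of_int (\<Sum>e\<in>E. (\<Sum>t\<in>T. edge_coeff e t * W j t)\<^sup>2) / of_int (\<Sum>t\<in>T. (W j t)\<^sup>2))
    \<le> (\<Sum>j<k. (\<Sum>\<tau>\<in>faces (Suc (card A)) cone.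
          (\<Sum>\<sigma>\<in>facet ` T. boundary_coeff ord \<tau> \<sigma> * weight ord (W j) \<sigma>)\<^sup>2)
        / (\<Sum>\<sigma>\<in>facet ` T. (weight ord (W j) \<sigma>)\<^sup>2))"
    by (intro sum_mono) simp
  also have "\<dots> \<le> (\<Sum>i=1..k. up_eigenvalue ord (Suc (card A)) cone i)"
    using ky_fan_up_laplacian[OF \<open>finite cone\<close>, where k = k and d = "Suc (card A)"
        and w = "\<lambda>j. weight ord (W j)" and ord = ord]
      orth unfolding facets_of_cone sum_weight_mult by simp
  finally show ?thesis
    by (simp add: sum.distrib)
qed

end


section \<open>The counterexample\<close>

definition base_triangles :: "(nat \<times> nat \<times> nat) list" where
  "base_triangles =
     [(1,2,4), (1,2,6), (1,2,7), (1,3,4), (1,3,5), (1,3,6), (1,3,7), (1,4,5), (1,4,6), (1,4,7),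
      (1,5,6), (1,5,7), (1,6,7), (2,5,6), (4,5,6), (4,5,7), (4,6,7), (5,6,7)]"

text \<open>All pairs from 1 to 7 except 23, which lies in no triangle.\<close>

definition base_edges :: "(nat \<times> nat) list" where
  "base_edges =
     [(1,2), (1,3), (1,4), (1,5), (1,6), (1,7), (2,4), (2,5), (2,6), (2,7),
      (3,4), (3,5), (3,6), (3,7), (4,5), (4,6), (4,7), (5,6), (5,7), (6,7)]"

text \<open>With \<open>s\<^sub>e\<close> the signed star of the edge \<open>e\<close>, the first two rows are
  \<open>5 s\<^sub>1\<^sub>6 + s\<^sub>1\<^sub>4\<close> and \<open>4 s\<^sub>1\<^sub>7 + s\<^sub>1\<^sub>4 + s\<^sub>1\<^sub>6\<close>; the last two approximate eigenvectors inside the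
  rational 5-dimensional invariant subspace on which \<open>B\<^sup>T B\<close> has the irrational eigenvalues.\<close>
definition base_weights :: "int list list" where
  "base_weights =
     [[-1, -5, 0, -1, 0, -5, 0, 1, -4, 1, -5, 0, 5, 0, 0, 0, 0, 0],
      [-1, -1, -4, -1, 0, -1, -4, 1, 0, -3, -1, -4, -3, 0, 0, 0, 0, 0],
      [-1, -2, -1, 32, 63, 32, 32, 34, -3, 0, -24, -34, 3, 4, 13, 0, 0, 13],
      [-2, -6, -2, -1, -4, -1, -1, 1, -4, 0, 15, -1, 4, 20, 20, 0, 0, 20]]"

text \<open>The default 0 makes these vectors vanish on the fan triangles, whatever \<open>q\<close>
  is.\<close>

definition base_weight :: "nat \<Rightarrow> nat \<times> nat \<times> nat \<Rightarrow> int" where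
  "base_weight i t = (case map_of (zip base_triangles (base_weights ! i)) t of None \<Rightarrow> 0 | Some x \<Rightarrow> x)"

definition test_weight :: "nat \<Rightarrow> nat \<times> nat \<times> nat \<Rightarrow> int" where
  "test_weight = case_nat (edge_coeff (1, 4)) base_weight"

abbreviation fan :: "nat \<Rightarrow> (nat \<Rightarrow> nat) \<Rightarrow> (nat \<times> nat \<times> nat) set" where
  "fan q v \<equiv> (\<lambda>h. (1, 4, v h)) ` {1..q}"

text \<open>Working on lists lets the simplifier evaluate all Gram and energy computations.\<close>

definition dot :: "int list \<Rightarrow> int list \<Rightarrow> int" where
  "dot xs ys = sum_list (map2 (*) xs ys)"

lemma all_less_4: "(\<forall>i<4. P i) \<longleftrightarrow> P 0 \<and> P 1 \<and> P 2 \<and> P (3 :: nat)"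
  by (auto simp: less_Suc_eq numeral_eq_Suc)

lemma length_base: "length base_triangles = 18" "i < 4 \<Longrightarrow> length (base_weights ! i) = 18"
proof -
  have "\<forall>i<4. length (base_weights ! i) = 18"
    unfolding all_less_4 by (simp add: base_weights_def)
  then show "i < 4 \<Longrightarrow> length (base_weights ! i) = 18"
    by blast
qed (simp add: base_triangles_def)

lemma distinct_base: "distinct base_triangles" "distinct base_edges"
  by (simp_all add: base_triangles_def base_edges_def)

lemma base_triangles_range: "(a, b, c) \<in> set base_triangles \<Longrightarrow> 1 \<le> a \<and> a < b \<and> b < c \<and> c \<le> 7"
  by (auto simp: base_triangles_def)

lemma base_edges_range: "(a, b) \<in> set base_edges \<Longrightarrow> 1 \<le> a \<and> a < b \<and> b \<le> 7"
  by (auto simp: base_edges_def)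

lemma base_edges_cover: "(a, b) \<in> set base_edges \<Longrightarrow> \<exists>t\<in>set base_triangles. {a, b} \<subseteq> verts t"
  by (auto simp: base_edges_def base_triangles_def)

lemma map_base_weight:
  assumes "i < 4"
  shows "map (base_weight i) base_triangles = base_weights ! i"
proof (rule nth_equalityI)
  fix k assume "k < length (map (base_weight i) base_triangles)"
  then show "map (base_weight i) base_triangles ! k = base_weights ! i ! k"
    using length_base assms distinct_base by (simp add: base_weight_def map_of_zip_nth)
qed (use length_base assms in simp)

lemma base_weight_outside: "t \<notin> set base_triangles \<Longrightarrow> base_weight i t = 0"
proof -
  assume "t \<notin> set base_triangles"
  then have "map_of (zip base_triangles (base_weights ! i)) t = None"
    by (metis map_of_eq_None_iff in_set_zipE imageE prod.collapse)
  then show ?thesis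
    by (simp add: base_weight_def)
qed

lemma dot_map: "dot (map f xs) (map g xs) = (\<Sum>x\<leftarrow>xs. f x * g x)"
  by (simp add: dot_def map2_map_map)

lemma base_gram:
  "\<forall>i<4. \<forall>j<4. dot (base_weights ! i) (base_weights ! j) = (if i = j then [120, 72, 10307, 1522] ! i else 0)"
  unfolding all_less_4 by (simp add: base_weights_def dot_def)

lemma base_star:
  "\<forall>i<4. dot (map (edge_coeff (1, 4)) base_triangles) (base_weights ! i) = 0"
  unfolding all_less_4 by (simp add: base_weights_def base_triangles_def dot_def)

text \<open>Divided by the squared norms in \<open>base_gram\<close>, these give 7, 7,
  \<open>61383/10307\<close> and \<open>9200/1522\<close>. The last two add up to
  \<open>12 + 2278/15687254\<close>, which is the whole margin of the counterexample.\<close>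

lemma base_energy:
  "\<forall>i<4. (\<Sum>e\<leftarrow>base_edges. (dot (map (edge_coeff e) base_triangles) (base_weights ! i))\<^sup>2)
      = [840, 504, 61383, 9200] ! i"
  unfolding all_less_4 by (simp add: base_weights_def base_triangles_def base_edges_def dot_def)

text \<open>\<open>x\<close> stands for what the fan adds at the edge 14. The five base triangles on
  14 have ten further edges, all distinct, each with coefficient 1 or -1.\<close>

lemma star_energy:
  "(\<Sum>e\<leftarrow>base_edges. (dot (map (edge_coeff e) base_triangles) (map (edge_coeff (1, 4)) base_triangles)
      + (if e = (1, 4) then x else 0))\<^sup>2) = (5 + x)\<^sup>2 + 10"
  by (simp add: base_triangles_def base_edges_def dot_def)

lemma star_norm:
  "dot (map (edge_coeff (1, 4)) base_triangles) (map (edge_coeff (1, 4)) base_triangles) = 5"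
  by (simp add: base_triangles_def dot_def)

section \<open>The cone over the triangles of \<open>K\<^sub>q\<close>\<close>

locale coned_fan =
  fixes q :: nat and v :: "nat \<Rightarrow> nat" and A :: "nat set"
  assumes inj_v: "inj_on v {1..q}" and v_new: "v ` {1..q} \<inter> {1..7} = {}"
    and fin_A: "finite A" and A_new: "A \<inter> ({1..7} \<union> v ` {1..q}) = {}"
begin

text \<open>The fan vertices can share the key 8 because no facet contains two of them. The shift by
  9 puts every apex above 8, even \<open>u = 0\<close>.\<close>

definition key :: "nat \<Rightarrow> nat" where
  "key u = (if u \<in> {1..7} then u else if u \<in> A then u + 9 else 8)"

definition triangles :: "(nat \<times> nat \<times> nat) set" where
  "triangles = set base_triangles \<union> fan q v"

lemma key_simps:
  "1 \<le> u \<Longrightarrow> u \<le> 7 \<Longrightarrow> key u = u" "h \<in> {1..q} \<Longrightarrow> key (v h) = 8" "u \<in> A \<Longrightarrow> key u = u + 9"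
proof -
  show "1 \<le> u \<Longrightarrow> u \<le> 7 \<Longrightarrow> key u = u"
    by (simp add: key_def)
  show "key (v h) = 8" if "h \<in> {1..q}"
  proof -
    have "v h \<in> v ` {1..q}"
      using that by blast
    then have "v h \<notin> {1..7}" "v h \<notin> A"
      using v_new A_new by blast+
    then show ?thesis
      unfolding key_def by (simp only: if_False)
  qed
  show "key u = u + 9" if "u \<in> A"
  proof -
    have "u \<notin> {1..7}"
      using that A_new by blast
    then show ?thesis
      using that unfolding key_def by (simp only: if_False if_True)
  qed
qed

lemma triangles_cases:
  assumes "(a, b, c) \<in> triangles"
  obtains "1 \<le> a" "a < b" "b < c" "c \<le> 7" | h where "a = 1" "b = 4" "c = v h" "h \<in> {1..q}"
  using assms base_triangles_range[of a b c] by (auto simp: triangles_def)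

sublocale coned_triangles triangles A key
proof
  fix a b c assume t: "(a, b, c) \<in> triangles"
  show 1: "key a < key b \<and> key b < key c"
    using t by (cases rule: triangles_cases) (simp_all add: key_simps)
  have "key c \<le> 8"
    using t by (cases rule: triangles_cases) (simp_all add: key_simps)
  then show "key c < key x" if "x \<in> A" for x
    using key_simps(3)[OF that] by simp
qed (auto simp: triangles_def fin_A key_simps inj_on_def)

lemma sum_triangles:
  fixes g :: "nat \<times> nat \<times> nat \<Rightarrow> int"
  shows "(\<Sum>t\<in>triangles. g t) = (\<Sum>t\<leftarrow>base_triangles. g t) + (\<Sum>h=1..q. g (1, 4, v h))"
proof -
  have disj: "set base_triangles \<inter> fan q v = {}"
  proof -
    have "(1, 4, v h) \<notin> set base_triangles" if "h \<in> {1..q}" for h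
      using base_triangles_range[of 1 4 "v h"] v_new that by fastforce
    then show ?thesis
      by blast
  qed
  have "inj_on (\<lambda>h. (1 :: nat, 4 :: nat, v h)) {1..q}"
    by (rule inj_onI) (simp add: inj_on_eq_iff[OF inj_v])
  then have "(\<Sum>t\<in>fan q v. g t) = (\<Sum>h=1..q. g (1, 4, v h))"
    by (simp add: sum.reindex)
  then show ?thesis
    unfolding triangles_def using disj distinct_base(1)
    by (simp add: sum.union_disjoint sum.distinct_set_conv_list)
qed

lemma fan_not_base: "h \<in> {1..q} \<Longrightarrow> v h \<notin> {1..7}"
  using v_new by blast

text \<open>The fan drops out, so one computation on the 18 base triangles serves every
  \<open>q\<close>.\<close>

lemma sum_base_weight:
  assumes "i < 4"
  shows "(\<Sum>t\<in>triangles. g t * base_weight i t) = dot (map g base_triangles) (base_weights ! i)"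
proof -
  have "base_weight i (1, 4, v h) = 0" if "h \<in> {1..q}" for h
    using base_weight_outside base_triangles_range[of 1 4 "v h"] fan_not_base[OF that] by fastforce
  then show ?thesis
    by (simp add: sum_triangles dot_map flip: map_base_weight[OF assms])
qed

lemma star_fan: "h \<in> {1..q} \<Longrightarrow> edge_coeff (1, 4) (1, 4, v h) = 1"
  using fan_not_base[of h] by auto

lemma sum_star:
  "(\<Sum>t\<in>triangles. g t * edge_coeff (1, 4) t)
     = dot (map g base_triangles) (map (edge_coeff (1, 4)) base_triangles) + (\<Sum>h=1..q. g (1, 4, v h))"
  unfolding sum_triangles dot_map by (simp only: star_fan mult_1_right cong: sum.cong)

text \<open>Each fan triangle brings two new edges besides 14.\<close>

definition edges :: "(nat \<times> nat) set" where
  "edges = set base_edges \<union> (\<lambda>h. (1, v h)) ` {1..q} \<union> (\<lambda>h. (4, v h)) ` {1..q}"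

lemma sum_edges:
  fixes g :: "nat \<times> nat \<Rightarrow> int"
  shows "(\<Sum>e\<in>edges. g e) = (\<Sum>e\<leftarrow>base_edges. g e) + (\<Sum>h=1..q. g (1, v h)) + (\<Sum>h=1..q. g (4, v h))"
proof -
  have "(a, v h) \<notin> set base_edges" if "h \<in> {1..q}" for a h
    using base_edges_range[of a "v h"] fan_not_base[OF that] by fastforce
  then have "set base_edges \<inter> (\<lambda>h. (1, v h)) ` {1..q} = {}"
    "(set base_edges \<union> (\<lambda>h. (1, v h)) ` {1..q}) \<inter> (\<lambda>h. (4, v h)) ` {1..q} = {}"
    by auto
  moreover have "inj_on (\<lambda>h. (a :: nat, v h)) {1..q}" for a
    by (rule inj_onI) (simp add: inj_on_eq_iff[OF inj_v])
  then have "(\<Sum>e\<in>(\<lambda>h. (a, v h)) ` {1..q}. g e) = (\<Sum>h=1..q. g (a, v h))" for a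
    by (simp add: sum.reindex)
  ultimately show ?thesis
    unfolding edges_def using distinct_base(2)
    by (simp add: sum.union_disjoint sum.distinct_set_conv_list)
qed

lemma edges_key:
  assumes "(a, b) \<in> edges"
  shows "key a < key b \<and> a \<notin> A \<and> b \<notin> A \<and> (\<exists>t\<in>triangles. {a, b} \<subseteq> verts t)"
proof -
  consider (base) "(a, b) \<in> set base_edges" | (one) h where "a = 1" "b = v h" "h \<in> {1..q}"
    | (four) h where "a = 4" "b = v h" "h \<in> {1..q}"
    using assms by (auto simp: edges_def)
  then show ?thesis
  proof cases
    case base
    have "a \<in> {1..7}" "b \<in> {1..7}"
      using base_edges_range[OF base] by auto
    then have "a \<notin> A" "b \<notin> A"
      using A_new by blast+
    moreover have "\<exists>t\<in>triangles. {a, b} \<subseteq> verts t"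
      using base_edges_cover[OF base] unfolding triangles_def by blast
    ultimately show ?thesis
      using base_edges_range[OF base] by (simp add: key_simps)
  next
    case one
    have "(1, 4, v h) \<in> triangles"
      using one by (simp add: triangles_def)
    then show ?thesis
      using notin_A[of 1 4 "v h"] one key_simps(2)[OF one(3)]
      by (auto simp: key_simps intro!: bexI[of _ "(1, 4, v h)"])
  next
    case four
    have "(1, 4, v h) \<in> triangles"
      using four by (simp add: triangles_def)
    then show ?thesis
      using notin_A[of 1 4 "v h"] four key_simps(2)[OF four(3)]
      by (auto simp: key_simps intro!: bexI[of _ "(1, 4, v h)"])
  qed
qed

lemma base_fan_edge_coeff: "e \<in> set base_edges \<Longrightarrow> h \<in> {1..q} \<Longrightarrow> edge_coeff e (1, 4, v h) = (if e = (1, 4) then 1 else 0)"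
  using base_edges_range[of "fst e" "snd e"] fan_not_base[of h] by (cases e) auto

text \<open>The energy is \<open>(5 + q)\<^sup>2\<close> from the edge 14, plus 10 from the other
  base edges, plus \<open>2 q\<close> from the new edges. It factors, so the quotient is
  \<open>7 + q\<close>.\<close>

lemma star_quotient:
  "(\<Sum>t\<in>triangles. (edge_coeff (1, 4) t)\<^sup>2) = 5 + int q"
  "(\<Sum>e\<in>edges. (\<Sum>t\<in>triangles. edge_coeff e t * edge_coeff (1, 4) t)\<^sup>2) = (5 + int q) * (7 + int q)"
proof -
  show "(\<Sum>t\<in>triangles. (edge_coeff (1, 4) t)\<^sup>2) = 5 + int q"
    unfolding power2_eq_square sum_star star_norm by (simp only: star_fan cong: sum.cong) simp
  let ?s = "\<lambda>e. \<Sum>t\<in>triangles. edge_coeff e t * edge_coeff (1, 4) t"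
  have s: "?s e = dot (map (edge_coeff e) base_triangles) (map (edge_coeff (1, 4)) base_triangles)
      + (if e = (1, 4) then int q else 0)" if "e \<in> set base_edges" for e
    unfolding sum_star by (simp only: base_fan_edge_coeff[OF that] cong: sum.cong) simp
  have base: "(\<Sum>e\<leftarrow>base_edges. (?s e)\<^sup>2) = (5 + int q)\<^sup>2 + 10"
    unfolding star_energy[symmetric] by (intro arg_cong[of _ _ sum_list] map_cong refl) (simp only: s)
  \<comment> \<open>The edge from \<open>a\<close> to \<open>v h\<close> lies in a single triangle;
    the coefficient is -1 for \<open>a = 1\<close> and 1 for \<open>a = 4\<close>.\<close>
  have new: "(?s (a, v h))\<^sup>2 = 1" if a: "a \<in> {1, 4}" and h: "h \<in> {1..q}" for a h
  proof -
    have "edge_coeff (a, v h) t = 0" if "t \<in> set base_triangles" for t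
    proof (cases t)
      case (fields x y z)
      then have "x \<in> {1..7}" "y \<in> {1..7}" "z \<in> {1..7}"
        using base_triangles_range[of x y z] that by auto
      then have "v h \<noteq> x" "v h \<noteq> y" "v h \<noteq> z"
        using fan_not_base[OF h] by metis+
      then show ?thesis
        by (simp add: fields)
    qed
    then have 0: "dot (map (edge_coeff (a, v h)) base_triangles) (map (edge_coeff (1, 4)) base_triangles) = 0"
      unfolding dot_map by (simp cong: map_cong)
    have "edge_coeff (a, v h) (1, 4, v k) = (if k = h then (if a = 1 then - 1 else 1) else 0)"
      if k: "k \<in> {1..q}" for k
    proof -
      have "v h = v k \<longleftrightarrow> k = h" and "v h \<noteq> 4"
        using inj_on_eq_iff[OF inj_v k h] fan_not_base[OF h] by auto
      then show ?thesis
        using a by auto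
    qed
    then have "(\<Sum>k=1..q. edge_coeff (a, v h) (1, 4, v k))
        = (\<Sum>k=1..q. if k = h then (if a = 1 then - 1 else 1) else 0)"
      by (rule sum.cong[OF refl])
    also have "\<dots> = (if a = 1 then - 1 else 1)"
      using h by (simp only: sum.delta finite_atLeastAtMost if_True)
    finally have "(\<Sum>k=1..q. edge_coeff (a, v h) (1, 4, v k)) = (if a = 1 then - 1 else 1)" .
    then show ?thesis
      unfolding sum_star 0 by auto
  qed
  have sum_new: "(\<Sum>h=1..q. (?s (a, v h))\<^sup>2) = int q" if "a \<in> {1, 4}" for a
  proof -
    have "(\<Sum>h=1..q. (?s (a, v h))\<^sup>2) = (\<Sum>h=1..q. 1)"
      by (rule sum.cong[OF refl]) (rule new[OF that])
    also have "\<dots> = int q"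
      by simp
    finally show ?thesis .
  qed
  have "(\<Sum>e\<in>edges. (?s e)\<^sup>2) = (5 + int q)\<^sup>2 + 10 + int q + int q"
    by (simp only: sum_edges base sum_new insertI1 insertI2)
  also have "\<dots> = (5 + int q) * (7 + int q)"
    by (simp add: power2_eq_square algebra_simps)
  finally show "(\<Sum>e\<in>edges. (?s e)\<^sup>2) = (5 + int q) * (7 + int q)" .
qed

text \<open>The energy is only bounded from below: the squares at the new edges are discarded as
  nonnegative.\<close>

lemma base_quotient:
  assumes i: "i < 4"
  shows "(\<Sum>t\<in>triangles. (base_weight i t)\<^sup>2) = [120, 72, 10307, 1522] ! i"
    and "[840, 504, 61383, 9200] ! i \<le> (\<Sum>e\<in>edges. (\<Sum>t\<in>triangles. edge_coeff e t * base_weight i t)\<^sup>2)"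
  using base_gram base_energy i
  by (auto simp: power2_eq_square sum_base_weight[OF i] map_base_weight sum_edges add.assoc sum_nonneg)

lemma test_weight_orthogonal:
  assumes "i < 5" "j < 5" "i \<noteq> j"
  shows "(\<Sum>t\<in>triangles. test_weight i t * test_weight j t) = 0"
proof (cases i)
  case 0
  then show ?thesis
    using assms base_star by (cases j) (auto simp: test_weight_def sum_base_weight)
next
  case (Suc i')
  show ?thesis
  proof (cases j)
    case 0
    then show ?thesis
      using assms base_star Suc
      by (simp add: test_weight_def mult.commute[of _ "edge_coeff _ _"] sum_base_weight)
  next
    case (Suc j')
    then show ?thesis
      using assms \<open>i = Suc i'\<close> base_gram by (simp add: test_weight_def sum_base_weight map_base_weight)
  qed
qed

lemma lessThan_5: "{..<5 :: nat} = {0, 1, 2, 3, 4}"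
  by auto

theorem top_eigenvalues_gt:
  assumes ord: "\<And>t. t \<in> triangles \<Longrightarrow> tournament_on (facet t) ord"
  shows "(\<Sum>i=1..5. up_eigenvalue ord (Suc (card A)) cone i) > 33 + real q + 5 * real (card A)"
proof -
  define N where "N j = (\<Sum>t\<in>triangles. (test_weight j t)\<^sup>2)" for j
  define Q where "Q j = (\<Sum>e\<in>edges. (\<Sum>t\<in>triangles. edge_coeff e t * test_weight j t)\<^sup>2)" for j
  have NQ0: "N 0 = 5 + int q" "Q 0 = (5 + int q) * (7 + int q)"
    by (simp_all only: N_def Q_def test_weight_def nat.case star_quotient)
  have NS: "N (Suc i) = [120, 72, 10307, 1522] ! i" and QS: "[840, 504, 61383, 9200] ! i \<le> Q (Suc i)"
    if "i < 4" for i
    using base_quotient[OF that] by (simp_all add: N_def Q_def test_weight_def)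
  have N: "N 1 = 120" "N 2 = 72" "N 3 = 10307" "N 4 = 1522"
    using NS[of 0] NS[of 1] NS[of 2] NS[of 3] by (simp_all add: eval_nat_numeral)
  have Q: "840 \<le> Q 1" "504 \<le> Q 2" "61383 \<le> Q 3" "9200 \<le> Q 4"
    using QS[of 0] QS[of 1] QS[of 2] QS[of 3] by (simp_all add: eval_nat_numeral)
  have "N j \<noteq> 0" if "j < 5" for j
  proof -
    have "j \<in> {0, 1, 2, 3, 4}"
      unfolding lessThan_5[symmetric] using that by simp
    moreover have "N 0 \<noteq> 0"
      unfolding NQ0 by simp
    ultimately show ?thesis
      by (elim insertE emptyE) (simp_all only: N, simp_all)
  qed
  then have ge: "real 5 * real (card A) + (\<Sum>j<5. real_of_int (Q j) / real_of_int (N j))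
      \<le> (\<Sum>i=1..5. up_eigenvalue ord (Suc (card A)) cone i)"
    unfolding N_def Q_def
    by (intro sum_up_eigenvalue_ge ord edges_key test_weight_orthogonal) (auto simp: edges_def)
  have sum5: "(\<Sum>j<5. g j) = g 0 + g 1 + g 2 + g 3 + g 4" for g :: "nat \<Rightarrow> real"
    by (simp add: lessThan_5 add.assoc)
  have "real_of_int (Q 0) / real_of_int (N 0) = 7 + real q"
    unfolding NQ0 by (simp add: field_simps)
  moreover have "real_of_int (Q 1) / 120 \<ge> 7" "real_of_int (Q 2) / 72 \<ge> 7"
    "real_of_int (Q 3) / 10307 \<ge> 61383 / 10307" "real_of_int (Q 4) / 1522 \<ge> 9200 / 1522"
    using Q by (simp_all add: field_simps)
  \<comment> \<open>The first three quotients contribute at least \<open>21 + q\<close>, and the two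
    fractions together slightly more than 12.\<close>
  ultimately have "(\<Sum>j<5. real_of_int (Q j) / real_of_int (N j)) > 33 + real q"
    unfolding sum5 N of_int_numeral by linarith
  with ge show ?thesis
    by simp
qed

section \<open>Vertices and degrees\<close>

lemma triangles_nonempty: "triangles \<noteq> {}"
  by (simp add: triangles_def base_triangles_def)

lemma vertices_cone: "vertices cone = A \<union> {1..7} \<union> v ` {1..q}"
proof -
  have "(\<Union>t\<in>set base_triangles. verts t) = {1..7}"
    by (auto simp: base_triangles_def)
  moreover have "(\<Union>t\<in>fan q v. verts t) = (\<Union>h\<in>{1..q}. {1, 4, v h})"
    by (simp add: image_image)
  moreover have "1 \<in> {1..7 :: nat}" "4 \<in> {1..7 :: nat}"
    by auto
  ultimately have "(\<Union>t\<in>triangles. verts t) = {1..7} \<union> v ` {1..q}"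
    unfolding triangles_def UN_Un by (simp only:) blast
  then show ?thesis
    using triangles_nonempty unfolding cone_def vertices_generated_complex facet_def by (simp add: UN_Un_distrib Un_assoc)
qed

lemma card_vertices_cone: "card (vertices cone) = card A + 7 + q"
proof -
  have "card (A \<union> {1..7} \<union> v ` {1..q}) = card (A \<union> {1..7}) + card (v ` {1..q})"
    by (rule card_Un_disjoint) (use fin_A A_new v_new in auto)
  also have "card (A \<union> {1..7}) = card A + card {1..7 :: nat}"
    by (rule card_Un_disjoint) (use fin_A A_new in auto)
  finally show ?thesis
    using inj_v by (simp add: vertices_cone card_image)
qed

text \<open>For a vertex outside \<open>A\<close>, membership in a facet is decided by the triangle,
  so any list \<open>S\<close> of candidate triangles bounds the degree.\<close>

lemma deg0_cone_le:
  assumes "u \<notin> A" and "finite S" and "\<And>t. t \<in> triangles \<Longrightarrow> u \<in> verts t \<Longrightarrow> t \<in> S"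
  shows "deg0 cone u \<le> card S"
proof -
  have "dimension cone = Suc (Suc (card A))"
    unfolding cone_def
    by (rule dimension_generated_complex) (use finite_T facet_card triangles_nonempty in auto)
  then have "deg0 cone u = card {\<sigma> \<in> facet ` triangles. u \<in> \<sigma>}"
    by (simp add: deg0_def facets_of_cone)
  also have "\<dots> \<le> card (facet ` S)"
    by (rule card_mono) (use assms in \<open>auto simp: facet_def\<close>)
  also have "\<dots> \<le> card S"
    by (rule card_image_le) fact
  finally show ?thesis .
qed

lemma sum_deg0_conj_le: "(\<Sum>j=1..5. deg0_conj cone j) \<le> 33 + q + 5 * card A"
proof -
  let ?V = "vertices cone" and ?m = "\<lambda>u. min 5 (deg0 cone u)"
  have fin: "finite ?V"
    by (simp add: vertices_cone fin_A)
  \<comment> \<open>Double counting: a vertex \<open>u\<close> is counted for the thresholds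
    \<open>j\<close> from 1 to \<open>min 5 (deg0 cone u)\<close>.\<close>
  have "(\<Sum>j=1..5. deg0_conj cone j) = (\<Sum>j=1..5. \<Sum>u\<in>?V. if j \<le> deg0 cone u then 1 else 0)"
    using fin by (simp add: deg0_conj_def sum.If_cases Int_def)
  also have "\<dots> = (\<Sum>u\<in>?V. \<Sum>j=1..5. if j \<le> deg0 cone u then 1 else 0)"
    by (rule sum.swap)
  also have "\<dots> = (\<Sum>u\<in>?V. ?m u)"
  proof (rule sum.cong[OF refl])
    fix u
    have "{1..5} \<inter> {j. j \<le> deg0 cone u} = {1..?m u}"
      by auto
    then show "(\<Sum>j=1..5. if j \<le> deg0 cone u then 1 else 0) = ?m u"
      by (simp add: sum.If_cases)
  qed
  also have "\<dots> = (\<Sum>u\<in>A. ?m u) + (\<Sum>u\<in>{1..7}. ?m u) + (\<Sum>u\<in>v ` {1..q}. ?m u)"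
  proof -
    have "(\<Sum>u\<in>?V. ?m u) = (\<Sum>u\<in>A \<union> {1..7}. ?m u) + (\<Sum>u\<in>v ` {1..q}. ?m u)"
      unfolding vertices_cone by (rule sum.union_disjoint) (use fin_A A_new v_new in auto)
    also have "(\<Sum>u\<in>A \<union> {1..7}. ?m u) = (\<Sum>u\<in>A. ?m u) + (\<Sum>u\<in>{1..7}. ?m u)"
      by (rule sum.union_disjoint) (use fin_A A_new in auto)
    finally show ?thesis .
  qed
  \<comment> \<open>Apexes count at most 5 and fan vertices at most 1. Among 1 to 7, the vertices 2
    and 3 have degree at most 4 and the other five are capped at 5, so 33 is
    \<open>2 * 4 + 5 * 5\<close>.\<close>
  also have "\<dots> \<le> 5 * card A + 33 + q"
  proof (intro add_mono)
    show "(\<Sum>u\<in>A. ?m u) \<le> 5 * card A"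
      using sum_bounded_above[of A ?m 5] by simp
    have "deg0 cone (v h) \<le> 1" if h: "h \<in> {1..q}" for h
    proof -
      have "deg0 cone (v h) \<le> card {(1 :: nat, 4 :: nat, v h)}"
      proof (rule deg0_cone_le)
        show "v h \<notin> A"
          using h A_new by blast
        fix t assume t: "t \<in> triangles" "v h \<in> verts t"
        obtain a b c where abc: "t = (a, b, c)"
          by (cases t)
        have vh: "v h = a \<or> v h = b \<or> v h = c" "v h \<notin> {1..7}"
          using t(2) fan_not_base[OF h] by (simp_all add: abc)
        from t(1)[unfolded abc] show "t \<in> {(1, 4, v h)}"
        proof (cases rule: triangles_cases)
          case 1
          then have "a \<in> {1..7}" "b \<in> {1..7}" "c \<in> {1..7}"
            by auto
          then show ?thesis
            using vh by metis
        next
          case (2 k)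
          then show ?thesis
            using vh by (auto simp: abc)
        qed
      qed simp
      then show ?thesis
        by simp
    qed
    then have "?m u \<le> 1" if "u \<in> v ` {1..q}" for u
      using that by force
    then have "(\<Sum>u\<in>v ` {1..q}. ?m u) \<le> card (v ` {1..q})"
      using sum_bounded_above[of "v ` {1..q}" ?m 1] by simp
    then show "(\<Sum>u\<in>v ` {1..q}. ?m u) \<le> q"
      using inj_v by (simp add: card_image)
    have A: "2 \<notin> A" "3 \<notin> A"
      using A_new by auto
    have v: "v h \<noteq> 2" "v h \<noteq> 3" "2 \<noteq> v h" "3 \<noteq> v h" if "Suc 0 \<le> h" "h \<le> q" for h
      using fan_not_base[of h] that by auto
    have "deg0 cone 2 \<le> card {(1, 2, 4), (1, 2, 6), (1, 2, 7), (2 :: nat, 5 :: nat, 6 :: nat)}"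
      by (rule deg0_cone_le[OF A(1)]) (auto simp: triangles_def base_triangles_def v)
    moreover have "deg0 cone 3 \<le> card {(1, 3, 4), (1, 3, 5), (1, 3, 6), (1 :: nat, 3 :: nat, 7 :: nat)}"
      by (rule deg0_cone_le[OF A(2)]) (auto simp: triangles_def base_triangles_def v)
    ultimately have "?m u \<le> (if u \<in> {2, 3} then 4 else 5)" for u
      by auto
    then have "(\<Sum>u\<in>{1..7}. ?m u) \<le> (\<Sum>u\<in>{1..7 :: nat}. if u \<in> {2, 3} then 4 else 5)"
      by (intro sum_mono)
    also have "\<dots> = 33"
    proof -
      have "{1..7 :: nat} = {1, 2, 3, 4, 5, 6, 7}"
        by auto
      then show ?thesis
        by simp
    qed
    finally show "(\<Sum>u\<in>{1..7}. ?m u) \<le> 33" .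
  qed
  finally show ?thesis
    by simp
qed

end

section \<open>Identification with the complexes of the statement\<close>

lemma faces_base_complex: "faces 2 base_complex = verts ` set base_triangles"
proof -
  have "base_complex = generated_complex (verts ` set base_triangles)"
    unfolding base_complex_def base_triangles_def by simp
  moreover have "faces 2 (generated_complex (verts ` set base_triangles)) = verts ` set base_triangles"
    by (rule faces_generated_complex) (auto simp: base_triangles_def)
  ultimately show ?thesis
    by simp
qed

lemma vertices_base_complex: "vertices base_complex = {1..7}"
  unfolding base_complex_def vertices_generated_complex by auto

text \<open>\<open>Kq q v\<close> is the cone with empty apex set, so the facts about cones apply to
  it.\<close>

lemma faces_Kq:
  assumes "inj_on v {1..q}" and "v ` {1..q} \<inter> {1..7} = {}"
  shows "faces 2 (Kq q v) = verts ` (set base_triangles \<union> fan q v)"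
    and "vertices (Kq q v) = {1..7} \<union> v ` {1..q}"
proof -
  have Kq: "Kq q v = generated_complex (verts ` (set base_triangles \<union> fan q v))"
    unfolding Kq_def faces_base_complex image_Un
    by (rule arg_cong[of _ _ "\<lambda>S. generated_complex (_ \<union> S)"]) (auto simp: image_image)
  interpret coned_fan q v "{}"
    by unfold_locales (use assms in auto)
  have facet: "facet = verts"
    by (rule ext) (simp add: facet_def)
  have cone: "Kq q v = cone"
    unfolding Kq cone_def facet unfolding triangles_def ..
  show "faces 2 (Kq q v) = verts ` (set base_triangles \<union> fan q v)"
    using facets_of_cone unfolding cone facet triangles_def[symmetric] by (simp only: card.empty numeral_2_eq_2)
  show "vertices (Kq q v) = {1..7} \<union> v ` {1..q}"
    unfolding cone vertices_cone by simp
qed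

theorem proposition5p3:
  fixes n r :: nat and v :: "nat \<Rightarrow> nat" and A :: "nat set" and ord :: "nat rel"
  assumes "r \<ge> 2" and "n \<ge> r + 5"
    and "inj_on v {1..n - r - 5}" and "v ` {1..n - r - 5} \<inter> vertices base_complex = {}"
    and "finite A" and "card A = r - 2" and "A \<inter> vertices (Kq (n - r - 5) v) = {}"
    and "linear_order_on (vertices (Knr n r v A)) ord"
  shows "pure_complex r (Knr n r v A)
     \<and> card (vertices (Knr n r v A)) = n
     \<and> (\<Sum>i=1..5. up_eigenvalue ord (r - 1) (Knr n r v A) i)
           > (\<Sum>j=1..5. real (deg0_conj (Knr n r v A) j))
     \<and> \<not> majorized (up_eigenvalue ord (r - 1) (Knr n r v A))
             (\<lambda>j. real (deg0_conj (Knr n r v A) j))"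
proof -
  define q where "q = n - r - 5"
  have v: "inj_on v {1..q}" "v ` {1..q} \<inter> {1..7} = {}"
    using assms(3,4) by (simp_all add: q_def vertices_base_complex)
  interpret coned_fan q v A
    by unfold_locales (use v assms(5,7) faces_Kq(2)[OF v] in \<open>simp_all add: q_def\<close>)
  have K: "Knr n r v A = cone"
    unfolding Knr_def cone_def q_def[symmetric] faces_Kq(1)[OF v] triangles_def[symmetric]
    by (rule arg_cong[of _ _ generated_complex]) (auto simp: facet_def)
  \<comment> \<open>The ridges of the cone have dimension \<open>Suc (card A)\<close>, which is the
    level \<open>r - 1\<close> of the up-Laplacian.\<close>
  have r: "r = Suc (Suc (card A))" "r - 1 = Suc (card A)"
    using assms(1,6) by auto
  have "pure_complex r cone"
    unfolding cone_def r(1)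
    by (rule pure_generated_complex) (use finite_T facet_card triangles_nonempty in auto)
  moreover have "card (vertices cone) = n"
    unfolding card_vertices_cone using assms(2) r(1) by (simp add: q_def)
  moreover have gt: "(\<Sum>i=1..5. up_eigenvalue ord (r - 1) cone i) > (\<Sum>j=1..5. real (deg0_conj cone j))"
  proof -
    have "(\<Sum>j=1..5. real (deg0_conj cone j)) \<le> 33 + real q + 5 * real (card A)"
      using sum_deg0_conj_le by (simp flip: of_nat_sum)
    also have "\<dots> < (\<Sum>i=1..5. up_eigenvalue ord (Suc (card A)) cone i)"
    proof (rule top_eigenvalues_gt)
      fix t assume "t \<in> triangles"
      then have "facet t \<subseteq> vertices cone"
        unfolding cone_def vertices_generated_complex by blast
      then show "tournament_on (facet t) ord"
        using tournament_on_linear_order assms(8) by (simp add: K)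
    qed
    finally show ?thesis
      by (simp only: r(2))
  qed
  \<comment> \<open>The partial sums of length 5 already violate majorization.\<close>
  moreover have "\<not> majorized (up_eigenvalue ord (r - 1) cone) (\<lambda>j. real (deg0_conj cone j))"
  proof
    assume "majorized (up_eigenvalue ord (r - 1) cone) (\<lambda>j. real (deg0_conj cone j))"
    then have "(\<Sum>i=1..5. up_eigenvalue ord (r - 1) cone i) \<le> (\<Sum>j=1..5. real (deg0_conj cone j))"
      unfolding majorized_def by simp
    then show False
      using gt by simp
  qed
  ultimately show ?thesis
    unfolding K by blast
qed

end
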